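(* Let $0<\lambda<1/e$, $E(z)=\lambda e^z$, $x_0>\beta$ and $\varepsilon>0$. Then $\mathcal X(x_0,L^\varepsilon)\subset\mathcal J(E)\setminus\mathcal C$, where $\mathcal X(x_0,L^\varepsilon)=\{w\in\mathbb C:\operatorname{Re}E^j(w)>E^j(x_0)\text{ and }x_0<\operatorname{Re}E^j(w),\ |\operatorname{Im}E^j(w)|<L^\varepsilon(\operatorname{Re}E^j(w))\text{ for all }j\in\mathbb N\}$.
   Context: For $0<\lambda<1/e$, $E(z)=\lambda e^z$ has real fixed points $\alpha<1<\beta$ ($\alpha$ attracting, $\beta$ repelling, $E'(\beta)=\beta$). $\mathcal J(E)$ is the Julia set; by Devaney–Krych it is a union of pairwise disjoint curves ("hairs") each joining a finite endpoint to $\infty$, each hair being the set of points of $\mathcal J(E)$ with a given itinerary (the sequence $(s_j)$ with $(2s_j-1)\pi\le\operatorname{Im}E^j(z)<(2s_j+1)\pi$); $\mathcal C$ is the set of endpoints of the hairs. Fractional iterates: $S$ is the entire solution of $S(\beta z)=E(S(z))$ with $S(0)=\beta$, $S'(0)=1$, an increasing bijection $\mathbb R\to(\alpha,\infty)$; for $r\in\mathbb R$, $E^r(\alpha)=\alpha$, $E^r(x)=S(\beta^rS^{-1}(x))$ for $x>\alpha$, and $L^r=E^{-r}$ (so $L(x)=\log x-\log\lambda$). *)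

theory Defs
  imports "HOL-Analysis.Analysis"
begin

definition Exp :: "real \<Rightarrow> complex \<Rightarrow> complex" where
  "Exp lam z = complex_of_real lam * exp z"

definition Expr :: "real \<Rightarrow> real \<Rightarrow> real" where
  "Expr lam x = lam * exp x"

definition alpha :: "real \<Rightarrow> real" where
  "alpha lam = (THE x. x < 1 \<and> lam * exp x = x)"

definition beta :: "real \<Rightarrow> real" where
  "beta lam = (THE x. 1 < x \<and> lam * exp x = x)"

text \<open>Normal families (in the spherical sense: every sequence has a subsequence converging
  locally uniformly to a finite limit function, or locally uniformly to infinity),
  Fatou set and Julia set.\<close>
definition normal_family_on :: "(nat \<Rightarrow> complex \<Rightarrow> complex) \<Rightarrow> complex set \<Rightarrow> bool" where
  "normal_family_on f U \<longleftrightarrow>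
     (\<forall>r::nat \<Rightarrow> nat. strict_mono r \<longrightarrow>
        (\<exists>s::nat \<Rightarrow> nat. strict_mono s \<and>
           ((\<exists>g. \<forall>K. compact K \<and> K \<subseteq> U \<longrightarrow>
                  uniform_limit K (\<lambda>n. f (r (s n))) g sequentially) \<or>
            (\<forall>K. compact K \<and> K \<subseteq> U \<longrightarrow>
                  (\<forall>M. eventually (\<lambda>n. \<forall>z\<in>K. M < norm (f (r (s n)) z)) sequentially)))))"

definition fatou_set :: "(complex \<Rightarrow> complex) \<Rightarrow> complex set" where
  "fatou_set f = {z. \<exists>U. open U \<and> z \<in> U \<and> normal_family_on (\<lambda>n. f ^^ n) U}"

definition julia_set :: "(complex \<Rightarrow> complex) \<Rightarrow> complex set" where
  "julia_set f = - fatou_set f"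

definition itinerary :: "real \<Rightarrow> complex \<Rightarrow> nat \<Rightarrow> int" where
  "itinerary lam z j = (THE s::int. (2 * of_int s - 1) * pi \<le> Im (((Exp lam) ^^ j) z) \<and>
                                      Im (((Exp lam) ^^ j) z) < (2 * of_int s + 1) * pi)"

definition hair :: "real \<Rightarrow> complex \<Rightarrow> complex set" where
  "hair lam z = {w \<in> julia_set (Exp lam). itinerary lam w = itinerary lam z}"

definition endpoints :: "real \<Rightarrow> complex set" where
  "endpoints lam = {z \<in> julia_set (Exp lam).
     \<exists>\<gamma>::real \<Rightarrow> complex. continuous_on {0..} \<gamma> \<and> inj_on \<gamma> {0..} \<and> \<gamma> 0 = z \<and>
        \<gamma> ` {0..} = hair lam z \<and> filterlim (\<lambda>t. norm (\<gamma> t)) at_top at_top}"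

definition poincare :: "real \<Rightarrow> complex \<Rightarrow> complex" where
  "poincare lam = (THE S. S holomorphic_on UNIV \<and>
       (\<forall>z. S (complex_of_real (beta lam) * z) = Exp lam (S z)) \<and>
       S 0 = complex_of_real (beta lam) \<and> deriv S 0 = 1)"

text \<open>Real restriction of S and its inverse (R \<rightarrow> (alpha, \<infinity>)).\<close>
definition Sreal :: "real \<Rightarrow> real \<Rightarrow> real" where
  "Sreal lam t = Re (poincare lam (complex_of_real t))"

definition Sinv :: "real \<Rightarrow> real \<Rightarrow> real" where
  "Sinv lam x = (THE t. poincare lam (complex_of_real t) = complex_of_real x)"

definition Efrac :: "real \<Rightarrow> real \<Rightarrow> real \<Rightarrow> real" where
  "Efrac lam r x = (if x = alpha lam then alpha lam
                    else Sreal lam (beta lam powr r * Sinv lam x))"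

definition Lfrac :: "real \<Rightarrow> real \<Rightarrow> real \<Rightarrow> real" where
  "Lfrac lam r x = Efrac lam (- r) x"

end

theory Submission
  imports Defs "HOL-Complex_Analysis.Complex_Analysis"
begin

text \<open>
  Since \<open>E\<close> maps the half-plane \<open>Re z < \<beta>\<close> into itself and expands by a factor of at least \<open>\<beta>\<close>
  where \<open>Re (E z) \<ge> \<beta>\<close>, Montel's and Bloch's theorems show that the Julia set consists of the points
  whose whole orbit satisfies \<open>Re \<ge> \<beta>\<close>. Two distinct points of a hair are driven apart by this
  expansion while their imaginary parts stay within \<open>2\<pi>\<close>, so that eventually their real parts differ
  by more than 4; a gap of 4 never closes again. This orders each hair linearly, and both the
  points above and the points below a given \<open>w\<close> form relatively open sets. Hence \<open>w\<close> is no
  endpoint as soon as its hair contains a point below \<open>w\<close>.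

  To find such a point, put \<open>t\<^sub>j = S\<inverse> (Re E\<^sup>j(w))\<close>. As \<open>Re E(z) \<le> E(Re z)\<close>, the sequence
  \<open>t\<^sub>j / \<beta>\<^sup>j\<close> decreases, to a limit \<open>\<tau> > 0\<close>. So \<open>Re E\<^sup>j(w) \<ge> E\<^sup>j(S(\<tau>))\<close>, whereas
  \<open>|Im E\<^sup>j(w)| \<le> E\<^sup>j(S(p \<tau>))\<close> for large \<open>j\<close>, with \<open>p = \<beta> powr (-\<epsilon>/2) < 1\<close>. Pulling back boxes of size
  about \<open>E\<^sup>n(S(p \<tau>))\<close> along the itinerary of \<open>w\<close> yields a point of the same hair that
  grows like \<open>E\<^sup>j(S(p \<tau>))\<close> only.
\<close>

section \<open>The Julia set as a set of orbits in a half-plane\<close>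

locale small_exponential =
  fixes lam :: real
  assumes lam_pos: "0 < lam" and lam_less: "lam < 1 / exp 1"
begin

abbreviation "\<beta> \<equiv> beta lam"

section \<open>Real fixed points\<close>

text \<open>Both facts require that the definite description in \<open>beta\<close> denotes.
  Uniqueness: for fixed points \<open>1 < x < y\<close> the tangent inequality for
  \<open>exp\<close> gives \<open>y >= x + x * (y - x) > y\<close>. Existence is the intermediate
  value theorem.\<close>

lemma beta: "1 < \<beta>" "lam * exp \<beta> = \<beta>"
proof -
  have uniq: False if "1 < x" "x < y" "lam * exp x = x" "lam * exp y = y" for x y :: real
  proof -
    have "y = lam * exp (x + (y - x))" using that by simp
    also have "\<dots> = x * exp (y - x)" using that by (simp only: exp_add) simp
    also have "\<dots> \<ge> x * (1 + (y - x))"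
      using that by (intro mult_left_mono) auto
    finally have "x * (1 + (y - x)) \<le> y" .
    moreover have "1 * (y - x) < x * (y - x)" using that by (intro mult_strict_right_mono) auto
    ultimately show False by (simp add: algebra_simps)
  qed
  have lam1: "lam * exp 1 < 1" using lam_less by (simp add: field_simps)
  have "1 < exp (1::real)" by simp
  with lam1 lam_pos have "lam < 1"
    by (smt (verit) mult_less_cancel_left1)
  \<comment> \<open>The right end \<open>2 / lam\<close> is chosen because
    \<open>exp u >= u\<^sup>2 / 2\<close> at \<open>u = 2 / lam\<close> is exactly
    \<open>lam * exp u >= u\<close>.\<close>
  have "\<exists>x\<ge>1. x \<le> 2 / lam \<and> lam * exp x - x = 0"
  proof (rule IVT')
    have "1 + 2 / lam + (2 / lam)\<^sup>2 / 2 \<le> exp (2 / lam)"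
      using lam_pos by (intro exp_lower_Taylor_quadratic) auto
    hence "(2 / lam)\<^sup>2 / 2 \<le> exp (2 / lam)" using lam_pos
      by (smt (verit) divide_nonneg_nonneg)
    hence "lam * ((2 / lam)\<^sup>2 / 2) \<le> lam * exp (2 / lam)"
      using lam_pos by (intro mult_left_mono) auto
    thus "0 \<le> lam * exp (2 / lam) - 2 / lam"
      using lam_pos by (simp add: power2_eq_square field_simps)
    show "1 \<le> 2 / lam" using lam_pos \<open>lam < 1\<close> by (simp add: field_simps)
  qed (use lam1 in \<open>auto intro!: continuous_intros\<close>)
  then obtain x where x: "x \<ge> 1" "lam * exp x = x" by auto
  with lam1 have "x \<noteq> 1" by auto
  with x have x: "1 < x" "lam * exp x = x" by auto
  have "1 < \<beta> \<and> lam * exp \<beta> = \<beta>"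
    unfolding beta_def
  proof (rule theI)
    show "1 < x \<and> lam * exp x = x" using x by simp
  next
    fix y assume "1 < y \<and> lam * exp y = y"
    with x uniq[of x y] uniq[of y x] show "y = x" by (meson linorder_cases)
  qed
  thus "1 < \<beta>" "lam * exp \<beta> = \<beta>" by auto
qed

lemma beta_pos: "0 < \<beta>"
  using beta(1) by simp

lemma eventually_le_beta_power: "\<forall>\<^sub>F n in sequentially. R \<le> \<beta> ^ n"
proof -
  obtain N where N: "R < \<beta> ^ N" using real_arch_pow[OF beta(1)] by blast
  have "R \<le> \<beta> ^ n" if "N \<le> n" for n
    using N power_increasing[OF that, of \<beta>] beta(1) by linarith
  thus ?thesis by (auto simp: eventually_sequentially)
qed

text \<open>This keeps arguments beyond \<beta> away from the exceptional case of
  \<open>Efrac\<close>. Uniqueness again uses a tangent, now at the larger of the two fixed points,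
  where the slope is below 1.\<close>

lemma alpha_less: "alpha lam < 1"
proof -
  have uniq: False if "y < 1" "x < y" "lam * exp x = x" "lam * exp y = y" for x y :: real
  proof -
    have "x = lam * exp (y + (x - y))" using that by simp
    also have "\<dots> = y * exp (x - y)" using that by (simp only: exp_add) simp
    also have "\<dots> \<ge> y * (1 + (x - y))"
      using that lam_pos by (intro mult_left_mono) (auto, smt (verit) exp_gt_zero mult_pos_pos)
    finally have "y * (1 + (x - y)) \<le> x" .
    moreover have "y * (y - x) < 1 * (y - x)" using that by (intro mult_strict_right_mono) auto
    ultimately show False by (simp add: algebra_simps)
  qed
  have lam1: "lam * exp 1 < 1" using lam_less by (simp add: field_simps)
  have "\<exists>x\<ge>0. x \<le> 1 \<and> lam * exp x - x = 0"
    by (rule IVT2') (use lam1 lam_pos in \<open>auto intro!: continuous_intros\<close>)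
  then obtain x where x: "x \<le> 1" "lam * exp x = x" by auto
  with lam1 have "x \<noteq> 1" by auto
  with x have x: "x < 1" "lam * exp x = x" by auto
  have "alpha lam < 1 \<and> lam * exp (alpha lam) = alpha lam"
    unfolding alpha_def
  proof (rule theI)
    show "x < 1 \<and> lam * exp x = x" using x by simp
  next
    fix y assume "y < 1 \<and> lam * exp y = y"
    with x uniq[of x y] uniq[of y x] show "y = x" by (meson linorder_cases)
  qed
  thus ?thesis by simp
qed

section \<open>Expansion on the real line and along orbits\<close>

lemma Expr_eq_beta: "Expr lam x = \<beta> * exp (x - \<beta>)"
  using beta by (simp add: Expr_def exp_diff field_simps)

text \<open>Recentred at the fixed point, the map shows its multiplier \<beta>, and
  \<open>exp\<close> is evaluated near 0.\<close>

lemma Exp_eq_beta: "Exp lam z = of_real \<beta> * exp (z - of_real \<beta>)"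
proof -
  have "complex_of_real lam * exp (of_real \<beta>) = \<beta>"
    using beta(2) by (metis exp_of_real of_real_mult)
  thus ?thesis by (simp add: Exp_def exp_diff field_simps)
qed

lemma norm_Exp: "norm (Exp lam z) = Expr lam (Re z)"
  using lam_pos by (simp add: Exp_def Expr_def norm_mult)

lemma Exp_of_real: "Exp lam (of_real x) = of_real (Expr lam x)"
  by (simp add: Exp_def Expr_def flip: exp_of_real)

lemma Exp_funpow_of_real: "(Exp lam ^^ n) (of_real x) = of_real ((Expr lam ^^ n) x)"
  by (induction n) (auto simp: Exp_of_real)

lemma Expr_beta [simp]: "Expr lam \<beta> = \<beta>"
  using beta by (simp add: Expr_def)

lemma Expr_mono: "x \<le> y \<Longrightarrow> Expr lam x \<le> Expr lam y"
  using lam_pos by (simp add: Expr_def)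

lemma Expr_funpow_mono: "x \<le> y \<Longrightarrow> (Expr lam ^^ n) x \<le> (Expr lam ^^ n) y"
  by (induction n) (auto intro: Expr_mono)

lemma Expr_funpow_beta [simp]: "(Expr lam ^^ n) \<beta> = \<beta>"
  by (induction n) auto

text \<open>The increment factors as \<open>Expr lam x * (exp (y - x) - 1)\<close>: the first factor
  is at least \<beta>, the second at least \<open>y - x\<close>.\<close>

lemma Expr_expand:
  assumes "\<beta> \<le> x" "x \<le> y"
  shows "\<beta> * (y - x) \<le> Expr lam y - Expr lam x"
proof -
  have "Expr lam y - Expr lam x = Expr lam x * (exp (y - x) - 1)"
    by (simp add: Expr_def algebra_simps flip: exp_add)
  moreover have "\<beta> * (y - x) \<le> Expr lam x * (exp (y - x) - 1)"
  proof (rule mult_mono)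
    show "\<beta> \<le> Expr lam x" using Expr_mono[OF assms(1)] by simp
    thus "0 \<le> Expr lam x" using beta_pos by simp
    show "y - x \<le> exp (y - x) - 1" using exp_ge_add_one_self[of "y - x"] by linarith
  qed (use assms in auto)
  ultimately show ?thesis by simp
qed

lemma Expr_funpow_expand:
  assumes "\<beta> \<le> x" "x \<le> y"
  shows "\<beta> ^ n * (y - x) \<le> (Expr lam ^^ n) y - (Expr lam ^^ n) x"
proof (induction n)
  case (Suc n)
  have "\<beta> ^ Suc n * (y - x) \<le> \<beta> * ((Expr lam ^^ n) y - (Expr lam ^^ n) x)"
    using Suc beta_pos by (simp add: mult.assoc)
  also have "\<dots> \<le> Expr lam ((Expr lam ^^ n) y) - Expr lam ((Expr lam ^^ n) x)"
    using Expr_funpow_mono[OF assms(1), of n] Expr_funpow_mono[OF assms(2), of n]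
    by (intro Expr_expand) auto
  finally show ?case by simp
qed auto

lemma Exp_has_derivative: "(Exp lam has_field_derivative Exp lam z) (at z)"
  unfolding Exp_def [abs_def] by (auto intro!: derivative_eq_intros)

lemma Exp_funpow_holomorphic: "(Exp lam ^^ n) holomorphic_on A"
proof (induction n)
  case (Suc n)
  have "(\<lambda>z. complex_of_real lam * exp ((Exp lam ^^ n) z)) holomorphic_on A"
    by (intro holomorphic_intros Suc)
  moreover have "Exp lam ^^ Suc n = (\<lambda>z. complex_of_real lam * exp ((Exp lam ^^ n) z))"
    by (rule ext) (simp add: Exp_def)
  ultimately show ?case by simp
qed (simp add: id_def)

lemma Exp_funpow_continuous: "continuous_on A (Exp lam ^^ n)"
  using Exp_funpow_holomorphic holomorphic_on_imp_continuous_on by blast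

lemma Re_le_norm_Exp_funpow:
  assumes "\<And>k. \<beta> \<le> Re ((Exp lam ^^ k) z)"
  shows "\<beta> \<le> norm ((Exp lam ^^ k) z)"
  using assms[of k] complex_Re_le_cmod order_trans by blast

text \<open>As \<open>Exp lam\<close> is its own derivative, the chain rule gives the product of the
  next \<open>n\<close> orbit points, each of modulus at least \<beta>.\<close>

lemma deriv_Exp_funpow_ge:
  assumes "\<And>k. \<beta> \<le> Re ((Exp lam ^^ k) z)"
  shows "\<beta> ^ n \<le> norm (deriv (Exp lam ^^ n) z)"
proof -
  have "\<exists>D. ((Exp lam ^^ n) has_field_derivative D) (at z) \<and> \<beta> ^ n \<le> norm D"
  proof (induction n)
    case 0
    show ?case by (intro exI[of _ 1]) (auto simp: id_def)
  next
    case (Suc n)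
    then obtain D where D: "((Exp lam ^^ n) has_field_derivative D) (at z)" "\<beta> ^ n \<le> norm D"
      by auto
    let ?D = "Exp lam ((Exp lam ^^ n) z) * D"
    have "((Exp lam ^^ Suc n) has_field_derivative ?D) (at z)"
      using DERIV_chain[OF Exp_has_derivative D(1)] by simp
    moreover have "\<beta> * \<beta> ^ n \<le> norm (Exp lam ((Exp lam ^^ n) z)) * norm D"
      using D(2) Re_le_norm_Exp_funpow[OF assms, of "Suc n"] beta_pos
      by (intro mult_mono) auto
    ultimately show ?case by (intro exI[of _ ?D]) (simp add: norm_mult o_def)
  qed
  thus ?thesis using DERIV_imp_deriv by fastforce
qed

section \<open>Orbits in the half-plane and normality\<close>

text \<open>Derivatives at \<open>z\<close> grow without bound, so by Bloch's theorem the images of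
  a small disc contain discs of any given radius. This excludes a finite limit function, which would
  bound the images. It excludes divergence to infinity as well, since a disc of radius 4 contains a
  point that two further steps bring close to 0.\<close>

lemma julia_setI:
  assumes z: "\<And>k. \<beta> \<le> Re ((Exp lam ^^ k) z)"
  shows "z \<in> julia_set (Exp lam)"
proof (rule ccontr)
  assume "z \<notin> julia_set (Exp lam)"
  then obtain U where U: "open U" "z \<in> U" "normal_family_on (\<lambda>n. Exp lam ^^ n) U"
    by (auto simp: julia_set_def fatou_set_def)
  obtain d where d: "0 < d" "cball z d \<subseteq> U"
    using U open_contains_cball by blast
  have large: "\<forall>\<^sub>F n in sequentially. \<exists>b. ball b R \<subseteq> (Exp lam ^^ n) ` ball z d" for R
  proof -
    \<comment> \<open>The 12 is the constant of Bloch's theorem.\<close>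
    have "\<forall>\<^sub>F n in sequentially. R * 12 / d \<le> \<beta> ^ n"
      by (rule eventually_le_beta_power)
    thus ?thesis
    proof eventually_elim
      case (elim n)
      hence "R * 12 / d \<le> norm (deriv (Exp lam ^^ n) z)"
        using deriv_Exp_funpow_ge[OF z, of n] by linarith
      hence "R \<le> d * norm (deriv (Exp lam ^^ n) z) / 12"
        using d(1) by (simp add: field_simps)
      from Bloch[OF Exp_funpow_holomorphic d(1) this] show ?case by blast
    qed
  qed
  have "strict_mono (\<lambda>n::nat. n)" by (simp add: strict_mono_def)
  with U(3) obtain s :: "nat \<Rightarrow> nat" where s: "strict_mono s" and
    lim: "(\<exists>g. \<forall>K. compact K \<and> K \<subseteq> U \<longrightarrow> uniform_limit K (\<lambda>n. Exp lam ^^ s n) g sequentially) \<or>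
      (\<forall>K. compact K \<and> K \<subseteq> U \<longrightarrow>
         (\<forall>M. \<forall>\<^sub>F n in sequentially. \<forall>z\<in>K. M < norm ((Exp lam ^^ s n) z)))"
    unfolding normal_family_on_def by blast
  have s_top: "filterlim s sequentially sequentially"
    using s by (rule filterlim_subseq)
  from lim show False
  proof
    assume "\<exists>g. \<forall>K. compact K \<and> K \<subseteq> U \<longrightarrow> uniform_limit K (\<lambda>n. Exp lam ^^ s n) g sequentially"
    then obtain g where g: "uniform_limit (cball z d) (\<lambda>n. Exp lam ^^ s n) g sequentially"
      using d(2) compact_cball by blast
    have "continuous_on (cball z d) g"
      by (rule uniform_limit_theorem[OF _ g]) (auto simp: Exp_funpow_continuous)
    hence "compact (g ` cball z d)"
      by (rule compact_continuous_image) auto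
    then obtain B where B: "\<And>x. x \<in> cball z d \<Longrightarrow> norm (g x) \<le> B"
      using compact_imp_bounded bounded_iff by (metis imageI)
    have 1: "\<forall>\<^sub>F n in sequentially. \<forall>x\<in>cball z d. dist ((Exp lam ^^ s n) x) (g x) < 1"
      using uniform_limitD[OF g, of 1] by simp
    have 2: "\<forall>\<^sub>F n in sequentially. \<exists>b. ball b (\<bar>B\<bar> + 2) \<subseteq> (Exp lam ^^ s n) ` ball z d"
      using eventually_compose_filterlim[OF large s_top] .
    obtain n b where n: "\<forall>x\<in>cball z d. dist ((Exp lam ^^ s n) x) (g x) < 1"
      and b: "ball b (\<bar>B\<bar> + 2) \<subseteq> (Exp lam ^^ s n) ` ball z d"
      using eventually_happens[OF eventually_conj[OF 1 2]] by auto
    have bound: "norm y < \<bar>B\<bar> + 1" if "y \<in> (Exp lam ^^ s n) ` ball z d" for y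
    proof -
      obtain x where x: "x \<in> cball z d" "y = (Exp lam ^^ s n) x"
        using \<open>y \<in> _\<close> ball_subset_cball by blast
      have "norm y \<le> dist y (g x) + norm (g x)"
        by (metis add.commute dist_norm norm_triangle_sub)
      also have "\<dots> < 1 + B" using n x(1) B[OF x(1)] unfolding x(2) by (intro add_less_le_mono) auto
      finally show ?thesis by linarith
    qed
    \<comment> \<open>Two points of the disc at distance \<open>2 * (\<bar>B\<bar> + 1)\<close>,
      whereas the image lies in the open disc of radius \<open>\<bar>B\<bar> + 1\<close> about
      0.\<close>
    have p: "b + of_real (\<bar>B\<bar> + 1) \<in> ball b (\<bar>B\<bar> + 2)" "b - of_real (\<bar>B\<bar> + 1) \<in> ball b (\<bar>B\<bar> + 2)"
      by (simp_all only: mem_ball dist_norm) (simp_all del: of_real_add add: norm_minus_commute)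
    have "norm (b + of_real (\<bar>B\<bar> + 1)) < \<bar>B\<bar> + 1" "norm (b - of_real (\<bar>B\<bar> + 1)) < \<bar>B\<bar> + 1"
      using p b bound by blast+
    from add_strict_mono[OF this]
    have "norm ((b + of_real (\<bar>B\<bar> + 1)) - (b - of_real (\<bar>B\<bar> + 1))) < 2 * (\<bar>B\<bar> + 1)"
      unfolding mult_2 by (rule order_le_less_trans[OF norm_triangle_ineq4])
    moreover have "(b + of_real (\<bar>B\<bar> + 1)) - (b - of_real (\<bar>B\<bar> + 1)) = of_real (2 * (\<bar>B\<bar> + 1))"
      by simp
    ultimately show False by (simp only: norm_of_real)
  next
    assume "\<forall>K. compact K \<and> K \<subseteq> U \<longrightarrow>
         (\<forall>M. \<forall>\<^sub>F n in sequentially. \<forall>z\<in>K. M < norm ((Exp lam ^^ s n) z))"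
    hence 1: "\<forall>\<^sub>F n in sequentially. \<forall>z\<in>cball z d. lam < norm ((Exp lam ^^ s n) z)"
      using d by auto
    \<comment> \<open>Two iterations are held back: the first takes a suitable point of the disc to
      the negative real axis, the second takes it from there into the disc of radius
      \<open>lam\<close>.\<close>
    have "filterlim (\<lambda>n. s n - 2) sequentially sequentially"
      by (rule filterlim_compose[OF filterlim_minus_const_nat_at_top s_top])
    from eventually_compose_filterlim[OF large this]
    have 2: "\<forall>\<^sub>F n in sequentially. \<exists>b. ball b 4 \<subseteq> (Exp lam ^^ (s n - 2)) ` ball z d" .
    have 3: "\<forall>\<^sub>F n in sequentially. 2 \<le> s n"
      using s_top by (simp add: filterlim_at_top)
    obtain n b where n: "\<forall>x\<in>cball z d. lam < norm ((Exp lam ^^ s n) x)" "2 \<le> s n"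
      and b: "ball b 4 \<subseteq> (Exp lam ^^ (s n - 2)) ` ball z d"
      using eventually_happens[OF eventually_conj[OF 1 eventually_conj[OF 2 3]]] by auto
    \<comment> \<open>\<open>y\<close> lies on the vertical line through \<open>b\<close> at a
      height that is an odd multiple of \<open>pi\<close>, hence at distance at most
      \<open>pi < 4\<close> from \<open>b\<close>.\<close>
    define k :: int where "k = \<lfloor>Im b / (2 * pi)\<rfloor>"
    define y where "y = Complex (Re b) (2 * pi * k + pi)"
    have "real_of_int k \<le> Im b / (2 * pi)" "Im b / (2 * pi) < real_of_int k + 1"
      unfolding k_def by linarith+
    hence "2 * pi * k \<le> Im b" "Im b < 2 * pi * k + 2 * pi"
      by (simp_all add: field_simps)
    hence "\<bar>Im b - Im y\<bar> \<le> pi" by (auto simp: y_def)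
    hence "y \<in> ball b 4"
      using pi_less_4 by (simp add: dist_norm y_def cmod_eq_Im)
    then obtain x where x: "x \<in> cball z d" "y = (Exp lam ^^ (s n - 2)) x"
      using b ball_subset_cball by blast
    have "cos (Im y) = -1"
      using cos_int_2pin[of k] sin_int_2pin[of k] by (simp add: y_def cos_add)
    hence "Re (Exp lam y) \<le> 0"
      using lam_pos by (simp add: Exp_def Re_exp mult_nonneg_nonneg)
    hence "norm (Exp lam (Exp lam y)) \<le> lam"
      unfolding norm_Exp using lam_pos by (simp add: Expr_def)
    moreover have "Exp lam (Exp lam y) = (Exp lam ^^ s n) x"
    proof -
      obtain m where "s n = 2 + m" using n(2) le_Suc_ex by blast
      thus ?thesis using x(2) by (simp add: numeral_2_eq_2)
    qed
    ultimately show False using n(1) x(1) by fastforce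
  qed
qed

lemma norm_Exp_funpow_less:
  assumes "Re z < \<beta>" 
  shows "norm ((Exp lam ^^ Suc n) z) < \<beta>"
proof (induction n)
  case 0
  show ?case using assms lam_pos beta by (simp add: norm_Exp Expr_def) (smt (verit) exp_less_cancel_iff mult_less_cancel_left_pos)
next
  case (Suc n)
  hence "Re ((Exp lam ^^ Suc n) z) < \<beta>" using complex_Re_le_cmod order_le_less_trans by blast
  hence "lam * exp (Re ((Exp lam ^^ Suc n) z)) < lam * exp \<beta>" using lam_pos by simp
  thus ?case using beta by (simp add: norm_Exp Expr_def)
qed

text \<open>If the orbit enters \<open>Re < \<beta>\<close> at time \<open>k\<close>, then on an
  open neighbourhood all later iterates are bounded by \<beta>, and Montel's theorem makes the
  family normal there.\<close>

lemma julia_setD: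
  assumes z: "z \<in> julia_set (Exp lam)"
  shows "\<beta> \<le> Re ((Exp lam ^^ k) z)"
proof (rule ccontr)
  assume less: "\<not> \<beta> \<le> Re ((Exp lam ^^ k) z)"
  define U where "U = (Exp lam ^^ k) -` {w. Re w < \<beta>}"
  have "open U" unfolding U_def
    by (intro open_vimage Exp_funpow_continuous open_halfspace_Re_lt)
  have bd: "norm ((Exp lam ^^ n) x) \<le> \<beta>" if x: "x \<in> U" and n: "k < n" for n x
  proof -
    obtain m where m: "n = Suc m + k" using less_imp_Suc_add[OF n] by auto
    have "(Exp lam ^^ n) x = (Exp lam ^^ Suc m) ((Exp lam ^^ k) x)"
      unfolding m funpow_add by simp
    thus ?thesis using norm_Exp_funpow_less[of "(Exp lam ^^ k) x" m] x by (simp add: U_def)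
  qed
  have "normal_family_on (\<lambda>n. Exp lam ^^ n) U"
    unfolding normal_family_on_def
  proof (intro allI impI)
    fix r :: "nat \<Rightarrow> nat" assume r: "strict_mono r"
    \<comment> \<open>Only iterates of index above \<open>k\<close> are bounded, so Montel's theorem
      is applied to the sequence shifted by \<open>Suc k\<close>.\<close>
    have rk: "k < r (n + Suc k)" for n
      using strict_mono_imp_increasing[OF r, of "n + Suc k"] by simp
    obtain g t where gt: "strict_mono (t :: nat \<Rightarrow> nat)"
      "\<And>K. compact K \<Longrightarrow> K \<subseteq> U \<Longrightarrow>
        uniform_limit K ((\<lambda>n. Exp lam ^^ r (n + Suc k)) \<circ> t) g sequentially"
    proof (rule Montel[where S = U and \<H> = "{Exp lam ^^ n |n. k < n}"
          and \<F> = "\<lambda>n. Exp lam ^^ r (n + Suc k)"])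
      show "\<exists>B. \<forall>h\<in>{Exp lam ^^ n |n. k < n}. \<forall>z\<in>K. norm (h z) \<le> B" if "K \<subseteq> U" for K
        using that bd by blast
    qed (use \<open>open U\<close> rk Exp_funpow_holomorphic in auto)
    have "strict_mono (\<lambda>n. t n + Suc k)" using gt(1) by (simp add: strict_mono_def)
    moreover have "\<forall>K. compact K \<and> K \<subseteq> U \<longrightarrow>
        uniform_limit K (\<lambda>n. Exp lam ^^ r (t n + Suc k)) g sequentially"
      using gt(2) by (simp add: o_def)
    ultimately show "\<exists>s::nat \<Rightarrow> nat. strict_mono s \<and>
           ((\<exists>g. \<forall>K. compact K \<and> K \<subseteq> U \<longrightarrow>
                  uniform_limit K (\<lambda>n. Exp lam ^^ r (s n)) g sequentially) \<or>
            (\<forall>K. compact K \<and> K \<subseteq> U \<longrightarrow>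
                  (\<forall>M. \<forall>\<^sub>F n in sequentially. \<forall>z\<in>K. M < norm ((Exp lam ^^ r (s n)) z))))"
      by blast
  qed
  moreover have "z \<in> U" using less by (simp add: U_def)
  ultimately show False using z \<open>open U\<close> by (auto simp: julia_set_def fatou_set_def)
qed

end

section \<open>The Poincare function\<close>

lemma norm_exp_minus_one_minus_le:
  fixes h :: complex
  assumes "norm h \<le> 1 / 2"
  shows "norm (exp h - 1 - h) \<le> 2 * norm h ^ 2"
proof -
  have "norm (exp h - (\<Sum>k\<le>1. h ^ k / fact k)) \<le> exp \<bar>Re h\<bar> * norm h ^ Suc 1 / fact 1"
    by (rule Taylor_exp)
  hence "norm (exp h - 1 - h) \<le> exp \<bar>Re h\<bar> * norm h ^ 2"
    by (simp add: numeral_2_eq_2 diff_diff_eq)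
  also have "\<dots> \<le> 2 * norm h ^ 2"
  proof (rule mult_right_mono)
    have "\<bar>Re h\<bar> \<le> 1 / 2" using abs_Re_le_cmod[of h] assms by linarith
    hence "exp \<bar>Re h\<bar> \<le> exp (1 / 2)" by simp
    thus "exp \<bar>Re h\<bar> \<le> 2" using exp_half_le2 by linarith
  qed simp
  finally show ?thesis .
qed

context small_exponential
begin

section \<open>Distortion of iterates near the fixed point\<close>

text \<open>With \<open>C\<close> for this constant, \<open>C + 8 <= C * \<beta>\<close> absorbs the
  quadratic error of \<open>exp\<close> in one step, \<open>C > 8\<close> keeps the relevant discs
  small, and the factor \<beta> bounds the accumulated distortion.\<close>

definition distortion_const :: real where "distortion_const = 8 * \<beta> / (\<beta> - 1)"

text \<open>A supersolution of the linearisation equation; it keeps the first \<open>n\<close> iterates of points at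
  distance \<open>O(\<beta>\<^sup>-\<^sup>n)\<close> from \<open>\<beta>\<close> under control.\<close>
definition majorant :: "real \<Rightarrow> real" where "majorant t = t + distortion_const * t\<^sup>2"

lemma distortion_const: "8 < distortion_const" "distortion_const * (\<beta> - 1) = 8 * \<beta>"
  using beta(1) by (auto simp: distortion_const_def field_simps)

lemma majorant_le:
  assumes "0 \<le> t" "distortion_const * t \<le> 1"
  shows "majorant t \<le> 2 * t" "majorant t \<le> 1 / 4"
proof -
  have "distortion_const * t * t \<le> 1 * t" using assms by (intro mult_right_mono) auto
  thus *: "majorant t \<le> 2 * t" by (simp add: majorant_def power2_eq_square mult.assoc)
  have "8 * t \<le> distortion_const * t" using assms distortion_const by (intro mult_right_mono) auto
  with assms * show "majorant t \<le> 1 / 4" by linarith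
qed

lemma le_majorant: "t \<le> majorant t"
  using distortion_const by (simp add: majorant_def)

text \<open>The quadratic error is at most \<open>8 * t\<^sup>2\<close>, as the radius is at most
  \<open>2 * t\<close>. It fits because the coefficient of \<open>t\<^sup>2\<close> may grow from
  \<open>distortion_const\<close> to \<open>distortion_const * \<beta>\<close>.\<close>

lemma norm_Exp_minus_beta_le:
  assumes "0 \<le> t" "distortion_const * t \<le> 1" "norm (z - of_real \<beta>) \<le> majorant t"
  shows "norm (Exp lam z - of_real \<beta>) \<le> majorant (\<beta> * t)"
proof -
  define h where "h = z - of_real \<beta>"
  have h: "norm h \<le> majorant t" using assms by (simp add: h_def)
  have "norm (exp h - 1) \<le> norm (exp h - 1 - h) + norm h"
    by (metis add.commute norm_triangle_sub)
  also have "\<dots> \<le> 2 * norm h ^ 2 + norm h"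
    using majorant_le(2)[OF assms(1,2)] h by (intro add_mono norm_exp_minus_one_minus_le) auto
  also have "\<dots> \<le> 2 * (2 * t) ^ 2 + majorant t"
    using h majorant_le(1)[OF assms(1,2)]
    by (intro add_mono mult_left_mono power_mono) auto
  also have "\<dots> = t + (distortion_const + 8) * t\<^sup>2"
    by (simp add: majorant_def algebra_simps power2_eq_square)
  also have "\<dots> \<le> t + (distortion_const * \<beta>) * t\<^sup>2"
    using distortion_const beta(1) by (intro add_left_mono mult_right_mono) (auto simp: algebra_simps)
  finally have "\<beta> * norm (exp h - 1) \<le> \<beta> * (t + (distortion_const * \<beta>) * t\<^sup>2)"
    using beta_pos by simp
  also have "\<dots> = majorant (\<beta> * t)"
    by (simp add: majorant_def algebra_simps power2_eq_square)
  also have "\<beta> * norm (exp h - 1) = norm (of_real \<beta> * (exp h - 1))"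
    using beta_pos by (simp add: norm_mult)
  also have "of_real \<beta> * (exp h - 1) = Exp lam z - of_real \<beta>"
    by (simp add: Exp_eq_beta h_def algebra_simps)
  finally show ?thesis .
qed

lemma Exp_lipschitz:
  assumes "norm (z - of_real \<beta>) \<le> r" "norm (w - of_real \<beta>) \<le> r"
  shows "norm (Exp lam z - Exp lam w) \<le> \<beta> * exp r * norm (z - w)"
proof (rule field_differentiable_bound[where S = "cball (of_real \<beta>) r" and f' = "Exp lam"])
  fix x assume "x \<in> cball (complex_of_real \<beta>) r"
  hence "norm (x - of_real \<beta>) \<le> r" by (simp add: dist_norm norm_minus_commute)
  hence "Re x - \<beta> \<le> r"
    using complex_Re_le_cmod[of "x - of_real \<beta>"] by simp
  thus "norm (Exp lam x) \<le> \<beta> * exp r"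
    using beta_pos by (simp add: norm_Exp Expr_eq_beta)
qed (use assms Exp_has_derivative in \<open>auto simp: dist_norm norm_minus_commute
      intro: has_field_derivative_at_within\<close>)

text \<open>At step \<open>k\<close> both orbits lie within \<open>2 * t * \<beta> ^ k\<close> of
  the fixed point, so that step stretches by at most \<beta> times the exponential of this radius.
  The exponent in the bound is the geometric sum of the radii.\<close>

lemma Exp_funpow_lipschitz_aux:
  assumes "0 \<le> t" "distortion_const * (t * \<beta> ^ n) \<le> 1"
    "norm (z - of_real \<beta>) \<le> majorant t" "norm (w - of_real \<beta>) \<le> majorant t"
  shows "norm ((Exp lam ^^ n) z - (Exp lam ^^ n) w)
    \<le> \<beta> ^ n * exp (2 * t * (\<beta> ^ n - 1) / (\<beta> - 1)) * norm (z - w)"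
  using assms
proof (induction n arbitrary: t z w)
  case (Suc n)
  have "1 \<le> \<beta> ^ Suc n" using beta(1) by (intro one_le_power) auto
  hence "distortion_const * t * 1 \<le> distortion_const * t * \<beta> ^ Suc n"
    using Suc.prems(1) distortion_const by (intro mult_left_mono) auto
  hence t: "distortion_const * t \<le> 1" using Suc.prems(2) by (simp add: mult.assoc)
  have "norm ((Exp lam ^^ Suc n) z - (Exp lam ^^ Suc n) w) =
      norm ((Exp lam ^^ n) (Exp lam z) - (Exp lam ^^ n) (Exp lam w))"
    by (simp only: funpow_Suc_right o_def)
  also have "\<dots> \<le> \<beta> ^ n * exp (2 * (\<beta> * t) * (\<beta> ^ n - 1) / (\<beta> - 1)) * norm (Exp lam z - Exp lam w)"
    using Suc.prems t beta_pos
    by (intro Suc.IH norm_Exp_minus_beta_le) (auto simp: mult_ac)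
  also have "\<dots> \<le> \<beta> ^ n * exp (2 * (\<beta> * t) * (\<beta> ^ n - 1) / (\<beta> - 1)) * (\<beta> * exp (2 * t) * norm (z - w))"
    using Suc.prems majorant_le(1)[OF Suc.prems(1) t] beta_pos
    by (intro mult_left_mono Exp_lipschitz) auto
  also have "\<dots> = \<beta> ^ Suc n * exp (2 * (\<beta> * t) * (\<beta> ^ n - 1) / (\<beta> - 1) + 2 * t) * norm (z - w)"
    by (simp add: exp_add)
  also have "2 * (\<beta> * t) * (\<beta> ^ n - 1) / (\<beta> - 1) + 2 * t = 2 * t * (\<beta> ^ Suc n - 1) / (\<beta> - 1)"
    using beta(1) by (simp add: field_simps)
  finally show ?case .
qed simp

lemma Exp_funpow_lipschitz:
  assumes "0 \<le> t" "distortion_const * (t * \<beta> ^ n) \<le> 1"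
    "norm (z - of_real \<beta>) \<le> majorant t" "norm (w - of_real \<beta>) \<le> majorant t"
  shows "norm ((Exp lam ^^ n) z - (Exp lam ^^ n) w) \<le> 2 * \<beta> ^ n * norm (z - w)"
proof -
  have "2 * t * (\<beta> ^ n - 1) / (\<beta> - 1) \<le> 1 / 2"
  proof -
    have "8 * \<beta> * (t * \<beta> ^ n) = distortion_const * (t * \<beta> ^ n) * (\<beta> - 1)"
      using distortion_const(2) by (metis mult.assoc mult.commute)
    also have "\<dots> \<le> 1 * (\<beta> - 1)" using assms beta(1) by (intro mult_right_mono) auto
    finally have "8 * \<beta> * (t * \<beta> ^ n) \<le> \<beta> - 1" by simp
    moreover have "1 * (t * \<beta> ^ n) \<le> \<beta> * (t * \<beta> ^ n)"
      using assms(1) beta(1) by (intro mult_right_mono) auto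
    ultimately have "8 * (t * \<beta> ^ n) \<le> \<beta> - 1" by linarith
    hence "2 * t * (\<beta> ^ n - 1) \<le> (\<beta> - 1) / 2" using assms(1) beta(1) by (simp add: algebra_simps)
    thus ?thesis using beta(1) by (simp add: field_simps)
  qed
  hence "exp (2 * t * (\<beta> ^ n - 1) / (\<beta> - 1)) \<le> exp (1 / 2)" by simp
  also have "\<dots> \<le> 2" by (rule exp_half_le2)
  finally have "\<beta> ^ n * exp (2 * t * (\<beta> ^ n - 1) / (\<beta> - 1)) * norm (z - w) \<le> \<beta> ^ n * 2 * norm (z - w)"
    using beta_pos by (intro mult_right_mono mult_left_mono) auto
  with Exp_funpow_lipschitz_aux[OF assms] show ?thesis by (simp add: mult_ac)
qed

section \<open>Construction of the linearising function\<close>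

definition approx :: "nat \<Rightarrow> complex \<Rightarrow> complex" where
  "approx n z = (Exp lam ^^ n) (of_real \<beta> + z / of_real (\<beta> ^ n))"

text \<open>Both approximants are \<open>n\<close>-th iterates, of
  \<open>Exp lam (\<beta> + h)\<close> and of its linearisation
  \<open>\<beta> + \<beta> * h\<close>. These starting points differ by \<open>O(h\<^sup>2)\<close>
  with \<open>h\<close> of order \<open>\<beta>\<^sup>-\<^sup>n\<close>, and iteration magnifies the
  difference by at most \<open>2 * \<beta> ^ n\<close>.\<close>

lemma approx_step:
  assumes "distortion_const * norm z \<le> 1"
  shows "norm (approx (Suc n) z - approx n z) \<le> 4 * (norm z)\<^sup>2 / \<beta> ^ Suc n"
proof -
  define h where "h = z / of_real (\<beta> ^ Suc n)"
  define t where "t = norm z / \<beta> ^ n"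
  have \<beta>n: "1 \<le> \<beta> ^ n" "0 < \<beta> ^ n" "1 \<le> \<beta> ^ Suc n"
    using beta(1) beta_pos one_le_power[of \<beta>] by auto (metis one_le_power less_imp_le power_Suc)
  have t0: "0 \<le> t" using \<beta>n by (simp add: t_def)
  have nh: "norm h = t / \<beta>" using beta_pos by (simp add: h_def t_def norm_divide norm_power norm_mult mult.commute)
  have nh2: "norm h = norm z / \<beta> ^ Suc n" unfolding nh t_def by (simp add: mult.commute)
  have ct: "distortion_const * (t * \<beta> ^ n) \<le> 1" using assms \<beta>n by (simp add: t_def)
  have "distortion_const * norm h \<le> distortion_const * norm z"
    using distortion_const(1) \<beta>n(3) unfolding nh2 by (intro mult_left_mono) (auto simp: divide_le_eq mult_le_cancel_left1)
  hence ch: "distortion_const * norm h \<le> 1" using assms by linarith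
  have "8 * norm h \<le> distortion_const * norm h" using distortion_const by (intro mult_right_mono) auto
  with ch have h_small: "norm h \<le> 1 / 2" by linarith
  \<comment> \<open>One step takes the control radius from \<open>majorant (norm h)\<close> to
    \<open>majorant t\<close>, as \<open>\<beta> * norm h = t\<close>.\<close>
  have E1: "norm (Exp lam (of_real \<beta> + h) - of_real \<beta>) \<le> majorant t"
    using norm_Exp_minus_beta_le[of "norm h" "of_real \<beta> + h"] ch le_majorant[of "norm h"] beta_pos nh t0
    by simp
  have zh: "z / of_real (\<beta> ^ n) = of_real \<beta> * h" using beta_pos by (simp add: h_def field_simps)
  have "norm (z / of_real (\<beta> ^ n)) = t" using beta_pos by (simp add: t_def norm_divide norm_power)
  hence E2: "norm ((of_real \<beta> + z / of_real (\<beta> ^ n)) - of_real \<beta>) \<le> majorant t"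
    using le_majorant[of t] by simp
  have "norm (approx (Suc n) z - approx n z) =
     norm ((Exp lam ^^ n) (Exp lam (of_real \<beta> + h)) - (Exp lam ^^ n) (of_real \<beta> + z / of_real (\<beta> ^ n)))"
    by (simp only: approx_def funpow_Suc_right o_def h_def)
  also have "\<dots> \<le> 2 * \<beta> ^ n * norm (Exp lam (of_real \<beta> + h) - (of_real \<beta> + z / of_real (\<beta> ^ n)))"
    by (rule Exp_funpow_lipschitz[OF t0 ct E1 E2])
  also have "Exp lam (of_real \<beta> + h) - (of_real \<beta> + z / of_real (\<beta> ^ n)) = of_real \<beta> * (exp h - 1 - h)"
    unfolding zh Exp_eq_beta by (simp add: algebra_simps)
  also have "2 * \<beta> ^ n * norm (of_real \<beta> * (exp h - 1 - h)) = 2 * \<beta> ^ Suc n * norm (exp h - 1 - h)"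
    using beta_pos by (simp add: norm_mult)
  also have "\<dots> \<le> 2 * \<beta> ^ Suc n * (2 * norm h ^ 2)"
    using h_small beta_pos by (intro mult_left_mono norm_exp_minus_one_minus_le) auto
  also have "\<dots> = 4 * (norm z)\<^sup>2 / \<beta> ^ Suc n"
    unfolding nh2 using beta_pos by (simp add: power2_eq_square)
  finally show ?thesis .
qed

text \<open>The bounds of \<open>approx_step\<close> are summed; the last factor is what the partial
  geometric sum leaves.\<close>

lemma approx_near:
  assumes "distortion_const * norm z \<le> 1"
  shows "norm (approx n z - of_real \<beta> - z) \<le> 4 * (norm z)\<^sup>2 / (\<beta> - 1) * (1 - 1 / \<beta> ^ n)"
proof (induction n)
  case (Suc n)
  have "norm (approx (Suc n) z - of_real \<beta> - z) \<le>
     norm (approx (Suc n) z - approx n z) + norm (approx n z - of_real \<beta> - z)"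
    using norm_triangle_ineq[of "approx (Suc n) z - approx n z" "approx n z - of_real \<beta> - z"]
    by (simp add: algebra_simps)
  also have "\<dots> \<le> 4 * (norm z)\<^sup>2 / \<beta> ^ Suc n + 4 * (norm z)\<^sup>2 / (\<beta> - 1) * (1 - 1 / \<beta> ^ n)"
    using Suc approx_step[OF assms, of n] by linarith
  also have "\<dots> = 4 * (norm z)\<^sup>2 / (\<beta> - 1) * ((\<beta> - 1) / \<beta> ^ Suc n + (1 - 1 / \<beta> ^ n))"
    using beta(1) by (simp add: distrib_left)
  also have "(\<beta> - 1) / \<beta> ^ Suc n + (1 - 1 / \<beta> ^ n) = 1 - 1 / \<beta> ^ Suc n"
    using beta(1) by (simp add: field_simps)
  finally show ?case .
qed (simp add: approx_def)

definition koenigs :: "complex \<Rightarrow> complex" where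
  "koenigs z = lim (\<lambda>n. approx n z)"

definition koenigs_radius :: real where "koenigs_radius = 1 / distortion_const"

lemma koenigs_radius_pos: "0 < koenigs_radius"
  using distortion_const by (simp add: koenigs_radius_def)

lemma le_koenigs_radius_iff: "x \<le> koenigs_radius \<longleftrightarrow> distortion_const * x \<le> 1"
  using distortion_const by (simp add: koenigs_radius_def field_simps)

text \<open>The telescoping series of consecutive differences is dominated by a geometric one with
  ratio \<open>1 / \<beta>\<close>.\<close>

lemma approx_uniform_limit: "uniform_limit (cball 0 koenigs_radius) approx koenigs sequentially"
proof -
  have "uniform_limit (cball 0 koenigs_radius) (\<lambda>n z. \<Sum>i<n. approx (Suc i) z - approx i z)
      (\<lambda>z. suminf (\<lambda>i. approx (Suc i) z - approx i z)) sequentially"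
  proof (rule Weierstrass_m_test)
    fix n z assume "z \<in> cball (0::complex) koenigs_radius"
    hence z: "norm z \<le> koenigs_radius" by simp
    have "norm (approx (Suc n) z - approx n z) \<le> 4 * (norm z)\<^sup>2 / \<beta> ^ Suc n"
      using z by (intro approx_step) (simp add: le_koenigs_radius_iff)
    also have "\<dots> \<le> 4 * koenigs_radius\<^sup>2 / \<beta> ^ Suc n"
      using z beta_pos by (intro divide_right_mono mult_left_mono power_mono) auto
    also have "\<dots> = 4 * koenigs_radius\<^sup>2 / \<beta> * (1 / \<beta>) ^ n"
      by (simp add: power_one_over field_simps)
    finally show "norm (approx (Suc n) z - approx n z) \<le> 4 * koenigs_radius\<^sup>2 / \<beta> * (1 / \<beta>) ^ n" .
  next
    show "summable (\<lambda>n. 4 * koenigs_radius\<^sup>2 / \<beta> * (1 / \<beta>) ^ n)"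
      using beta(1) by (intro summable_mult summable_geometric) auto
  qed
  moreover have "(\<Sum>i<n. approx (Suc i) z - approx i z) + approx 0 z = approx n z" for n z
    using sum_lessThan_telescope[of "\<lambda>i. approx i z" n] by simp
  ultimately have lim: "uniform_limit (cball 0 koenigs_radius) approx
      (\<lambda>z. suminf (\<lambda>i. approx (Suc i) z - approx i z) + approx 0 z) sequentially"
    using uniform_limit_add[OF _ uniform_limit_const[where c = "approx 0"]] by fastforce
  have "koenigs z = suminf (\<lambda>i. approx (Suc i) z - approx i z) + approx 0 z" if "z \<in> cball 0 koenigs_radius" for z
    unfolding koenigs_def by (rule limI) (rule tendsto_uniform_limitI[OF lim that])
  thus ?thesis
    by (intro uniform_limit_cong'[THEN iffD2, OF _ _ lim]) auto
qed

text \<open>This identity carries convergence and holomorphy from the small disc to the whole plane: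
  division by \<open>\<beta> ^ m\<close> brings any point into the disc, and \<open>m\<close>
  iterations undo it.\<close>

lemma approx_add: "approx (n + m) z = (Exp lam ^^ m) (approx n (z / of_real (\<beta> ^ m)))"
  by (simp add: approx_def add.commute[of n m] funpow_add power_add)

lemma norm_div_power_less:
  assumes "0 < r" obtains m where "norm z / \<beta> ^ m < r"
proof -
  obtain m where "norm z / r < \<beta> ^ m" using real_arch_pow[OF beta(1)] by blast
  thus ?thesis using assms beta_pos that by (simp add: field_simps)
qed

lemma isCont_Exp_funpow: "isCont (Exp lam ^^ m) z"
  using Exp_funpow_continuous[of UNIV m] by (simp add: continuous_on_eq_continuous_at)

lemma approx_tendsto_aux:
  assumes "norm z / \<beta> ^ m \<le> koenigs_radius"
  shows "(\<lambda>n. approx n z) \<longlonglongrightarrow> (Exp lam ^^ m) (koenigs (z / of_real (\<beta> ^ m)))"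
proof -
  have "z / of_real (\<beta> ^ m) \<in> cball 0 koenigs_radius"
    using assms beta_pos by (simp add: norm_divide norm_power)
  hence "(\<lambda>n. approx n (z / of_real (\<beta> ^ m))) \<longlonglongrightarrow> koenigs (z / of_real (\<beta> ^ m))"
    by (rule tendsto_uniform_limitI[OF approx_uniform_limit])
  hence "(\<lambda>n. (Exp lam ^^ m) (approx n (z / of_real (\<beta> ^ m)))) \<longlonglongrightarrow> (Exp lam ^^ m) (koenigs (z / of_real (\<beta> ^ m)))"
    by (rule isCont_tendsto_compose[OF isCont_Exp_funpow])
  hence "(\<lambda>n. approx (n + m) z) \<longlonglongrightarrow> (Exp lam ^^ m) (koenigs (z / of_real (\<beta> ^ m)))"
    by (simp only: approx_add)
  thus ?thesis by (rule LIMSEQ_offset)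
qed

lemma koenigs_eq:
  assumes "norm z / \<beta> ^ m \<le> koenigs_radius"
  shows "koenigs z = (Exp lam ^^ m) (koenigs (z / of_real (\<beta> ^ m)))"
  unfolding koenigs_def[of z] by (rule limI[OF approx_tendsto_aux[OF assms]])

lemma approx_tendsto: "(\<lambda>n. approx n z) \<longlonglongrightarrow> koenigs z"
proof -
  obtain m where "norm z / \<beta> ^ m < koenigs_radius"
    using norm_div_power_less[OF koenigs_radius_pos] by blast
  thus ?thesis using approx_tendsto_aux[of z m] koenigs_eq[of z m] by simp
qed

lemma koenigs_holomorphic_ball: "koenigs holomorphic_on ball 0 koenigs_radius"
proof (rule holomorphic_uniform_sequence[where f = approx])
  fix n show "approx n holomorphic_on ball 0 koenigs_radius"
  proof -
    have "((Exp lam ^^ n) \<circ> (\<lambda>z. of_real \<beta> + z / of_real (\<beta> ^ n))) holomorphic_on ball 0 koenigs_radius"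
      using beta_pos by (intro holomorphic_on_compose Exp_funpow_holomorphic holomorphic_intros) auto
    thus ?thesis by (simp add: approx_def [abs_def] o_def)
  qed
next
  fix x assume "x \<in> ball (0::complex) koenigs_radius"
  then obtain d where "0 < d" "cball x d \<subseteq> ball 0 koenigs_radius"
    using open_contains_cball open_ball by blast
  thus "\<exists>d>0. cball x d \<subseteq> ball 0 koenigs_radius \<and> uniform_limit (cball x d) approx koenigs sequentially"
    using uniform_limit_on_subset[OF approx_uniform_limit] ball_subset_cball by (meson order_trans)
qed auto

lemma koenigs_holomorphic: "koenigs holomorphic_on UNIV"
proof -
  have "koenigs field_differentiable at z" for z
  proof -
    obtain m where m: "norm z / \<beta> ^ m < koenigs_radius"
      using norm_div_power_less[OF koenigs_radius_pos] by blast
    let ?B = "ball 0 (koenigs_radius * \<beta> ^ m)"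
    have "((Exp lam ^^ m) \<circ> (koenigs \<circ> (\<lambda>z. z / of_real (\<beta> ^ m)))) holomorphic_on ?B"
      using beta_pos
      by (intro holomorphic_on_compose Exp_funpow_holomorphic holomorphic_intros
          holomorphic_on_subset[OF koenigs_holomorphic_ball])
        (auto simp: norm_divide norm_power field_simps)
    moreover have "((Exp lam ^^ m) \<circ> (koenigs \<circ> (\<lambda>z. z / of_real (\<beta> ^ m)))) w = koenigs w" if "w \<in> ?B" for w
      using that beta_pos koenigs_eq[of w m] by (simp add: field_simps)
    ultimately have "koenigs holomorphic_on ?B"
      by (rule holomorphic_transform)
    moreover have "z \<in> ?B" using m beta_pos by (simp add: field_simps)
    ultimately show ?thesis
      by (simp add: holomorphic_on_imp_differentiable_at)
  qed
  thus ?thesis by (simp add: holomorphic_on_def)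
qed

lemma koenigs_scale: "koenigs (of_real \<beta> * z) = Exp lam (koenigs z)"
proof -
  have "approx (Suc n) (of_real \<beta> * z) = Exp lam (approx n z)" for n
    using approx_add[of n 1 "of_real \<beta> * z"] beta_pos by simp
  moreover have "(\<lambda>n. approx (Suc n) (of_real \<beta> * z)) \<longlonglongrightarrow> koenigs (of_real \<beta> * z)"
    using approx_tendsto by (rule LIMSEQ_Suc)
  moreover have "(\<lambda>n. Exp lam (approx n z)) \<longlonglongrightarrow> Exp lam (koenigs z)"
    by (rule isCont_tendsto_compose[OF DERIV_isCont[OF Exp_has_derivative] approx_tendsto])
  ultimately show ?thesis using LIMSEQ_unique by simp
qed

lemma koenigs_0: "koenigs 0 = of_real \<beta>"
proof -
  have "approx n 0 = of_real \<beta>" for n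
    by (simp add: approx_def Exp_funpow_of_real)
  thus ?thesis by (simp add: koenigs_def)
qed

lemma koenigs_near:
  assumes "norm z \<le> koenigs_radius"
  shows "norm (koenigs z - of_real \<beta> - z) \<le> 4 / (\<beta> - 1) * (norm z)\<^sup>2"
proof -
  have "(\<lambda>n. norm (approx n z - of_real \<beta> - z)) \<longlonglongrightarrow> norm (koenigs z - of_real \<beta> - z)"
    by (intro tendsto_intros approx_tendsto)
  moreover have "norm (approx n z - of_real \<beta> - z) \<le> 4 / (\<beta> - 1) * (norm z)\<^sup>2" for n
  proof -
    have "norm (approx n z - of_real \<beta> - z) \<le> 4 * (norm z)\<^sup>2 / (\<beta> - 1) * (1 - 1 / \<beta> ^ n)"
      using assms by (intro approx_near) (simp add: le_koenigs_radius_iff)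
    also have "\<dots> \<le> 4 * (norm z)\<^sup>2 / (\<beta> - 1) * 1"
      using beta(1) by (intro mult_left_mono) auto
    finally show ?thesis by simp
  qed
  ultimately show ?thesis by (intro LIMSEQ_le_const2) auto
qed

lemma koenigs_has_derivative_0: "(koenigs has_field_derivative 1) (at 0)"
  unfolding DERIV_def
proof (rule LIM_zero_cancel, rule Lim_null_comparison)
  have "\<forall>\<^sub>F h in at 0. h \<in> ball (0::complex) koenigs_radius \<and> h \<noteq> 0"
    using koenigs_radius_pos by (intro eventually_conj eventually_at_in_open' eventually_neq_at_within) auto
  thus "\<forall>\<^sub>F h in at 0. norm ((koenigs (0 + h) - koenigs 0) / h - 1) \<le> 4 / (\<beta> - 1) * norm h"
  proof eventually_elim
    case (elim h)
    have "(koenigs (0 + h) - koenigs 0) / h - 1 = (koenigs h - of_real \<beta> - h) / h"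
      using elim by (simp add: koenigs_0 field_simps)
    hence "norm ((koenigs (0 + h) - koenigs 0) / h - 1) = norm (koenigs h - of_real \<beta> - h) / norm h"
      by (simp only: norm_divide)
    also have "\<dots> \<le> (4 / (\<beta> - 1) * (norm h)\<^sup>2) / norm h"
      using elim by (intro divide_right_mono koenigs_near) auto
    finally show ?case using elim by (simp add: power2_eq_square)
  qed
  show "((\<lambda>h::complex. 4 / (\<beta> - 1) * norm h) \<longlongrightarrow> 0) (at 0)"
    using beta(1) by (auto intro!: tendsto_eq_intros)
qed

section \<open>Uniqueness of the linearising function\<close>

text \<open>At \<open>z / \<beta> ^ n\<close> the two solutions differ by
  \<open>o(\<beta>\<^sup>-\<^sup>n)\<close>, having the same value and derivative at 0. Bringing the
  difference back to \<open>z\<close> costs a factor of at most \<open>2 * \<beta> ^ n\<close>, so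
  it vanishes in the limit.\<close>

lemma linearizer_eq_koenigs:
  assumes T: "\<And>z. T (of_real \<beta> * z) = Exp lam (T z)" "T 0 = of_real \<beta>"
    "(T has_field_derivative 1) (at 0)"
  shows "T z = koenigs z"
proof -
  \<comment> \<open>Generalised over \<open>T\<close>, as it is applied to the given solution and to
    \<open>koenigs\<close> alike.\<close>
  have T_iter: "T z = (Exp lam ^^ n) (T (z / of_real (\<beta> ^ n)))"
    if T: "\<And>z. T (of_real \<beta> * z) = Exp lam (T z)" for T :: "complex \<Rightarrow> complex" and z n
  proof (induction n)
    case (Suc n)
    have "T (z / of_real (\<beta> ^ n)) = T (of_real \<beta> * (z / of_real (\<beta> ^ Suc n)))"
      using beta_pos by simp
    also have "\<dots> = Exp lam (T (z / of_real (\<beta> ^ Suc n)))" by (rule T)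
    finally show ?case using Suc by (simp add: funpow_swap1)
  qed simp
  have close: "\<forall>\<^sub>F n in sequentially. norm (T (z / of_real (\<beta> ^ n)) - of_real \<beta> - z / of_real (\<beta> ^ n))
      \<le> e * (norm z / \<beta> ^ n)"
    if T: "T 0 = of_real \<beta>" "(T has_field_derivative 1) (at 0)" and e: "0 < e" for T z e
  proof -
    obtain d where d: "d > 0" "\<And>y. norm y < d \<Longrightarrow> norm (T y - of_real \<beta> - y) \<le> e * norm y"
      using T e unfolding has_field_derivative_def has_derivative_at_alt by auto
    have "\<forall>\<^sub>F n in sequentially. (norm z + 1) / d \<le> \<beta> ^ n" by (rule eventually_le_beta_power)
    thus ?thesis
    proof eventually_elim
      case (elim n)
      have *: "norm (z / of_real (\<beta> ^ n)) = norm z / \<beta> ^ n"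
        using beta_pos by (simp add: norm_divide norm_power)
      have "norm z + 1 \<le> d * \<beta> ^ n" using elim d(1) by (simp add: field_simps)
      hence "norm z / \<beta> ^ n < d" using beta_pos by (simp add: field_simps)
      thus ?case using d(2)[of "z / of_real (\<beta> ^ n)"] unfolding * by simp
    qed
  qed
  have small: "T z = koenigs z" if z: "norm z \<le> koenigs_radius / 2" for z
  proof -
    have "norm (T z - koenigs z) \<le> e" if "e > 0" for e
    proof -
      \<comment> \<open>The bound 1 keeps both values inside the disc of radius
        \<open>majorant t\<close>; the other bound makes the final error
        \<open>4 * e' * norm z\<close> at most \<open>e\<close>.\<close>
      define e' where "e' = min 1 (e / (4 * (norm z + 1)))"
      have e': "0 < e'" "e' \<le> 1" "4 * e' * norm z \<le> e"
      proof -
        show "0 < e'" "e' \<le> 1" using \<open>e > 0\<close> by (auto simp: e'_def add_nonneg_pos)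
        have "e' * (4 * (norm z + 1)) \<le> e / (4 * (norm z + 1)) * (4 * (norm z + 1))"
          by (intro mult_right_mono) (auto simp: e'_def)
        also have "\<dots> = e" using norm_ge_zero[of z] by (simp add: add_nonneg_eq_0_iff)
        finally show "4 * e' * norm z \<le> e" using \<open>0 < e'\<close> by (simp add: algebra_simps)
      qed
      obtain n where n: "norm (T (z / of_real (\<beta> ^ n)) - of_real \<beta> - z / of_real (\<beta> ^ n)) \<le> e' * (norm z / \<beta> ^ n)"
        "norm (koenigs (z / of_real (\<beta> ^ n)) - of_real \<beta> - z / of_real (\<beta> ^ n)) \<le> e' * (norm z / \<beta> ^ n)"
        using eventually_happens[OF eventually_conj[OF close[OF T(2,3) e'(1)]
              close[OF koenigs_0 koenigs_has_derivative_0 e'(1)]]] by auto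
      define h where "h = z / of_real (\<beta> ^ n)"
      \<comment> \<open>Twice the norm of \<open>h\<close>, since each value is within
        \<open>(1 + e') * norm h\<close> of the fixed point. The radius was halved in
        \<open>small\<close> to pay for this.\<close>
      define t where "t = 2 * norm z / \<beta> ^ n"
      have nh: "norm h = norm z / \<beta> ^ n" using beta_pos by (simp add: h_def norm_divide norm_power)
      have "e' * (norm z / \<beta> ^ n) \<le> 1 * (norm z / \<beta> ^ n)" 
        using e' beta_pos by (intro mult_right_mono) auto
      hence le: "x \<le> e' * (norm z / \<beta> ^ n) \<Longrightarrow> x + norm h \<le> majorant t" for x
        using le_majorant[of t] by (simp add: t_def nh)
      have A: "norm (T h - of_real \<beta>) \<le> majorant t"
        using le[OF n(1)] norm_triangle_ineq[of "T h - of_real \<beta> - h" h] by (simp add: h_def)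
      have B: "norm (koenigs h - of_real \<beta>) \<le> majorant t"
        using le[OF n(2)] norm_triangle_ineq[of "koenigs h - of_real \<beta> - h" h] by (simp add: h_def)
      have "norm (T z - koenigs z) = norm ((Exp lam ^^ n) (T h) - (Exp lam ^^ n) (koenigs h))"
        using T_iter[of T z n, OF T(1)] T_iter[of koenigs z n, OF koenigs_scale] by (simp add: h_def)
      also have "\<dots> \<le> 2 * \<beta> ^ n * norm (T h - koenigs h)"
      proof (rule Exp_funpow_lipschitz[OF _ _ A B])
        show "0 \<le> t" using beta_pos by (simp add: t_def)
        show "distortion_const * (t * \<beta> ^ n) \<le> 1"
          using z beta_pos le_koenigs_radius_iff[of "2 * norm z"] by (simp add: t_def)
      qed
      also have "norm (T h - koenigs h) \<le> 2 * (e' * (norm z / \<beta> ^ n))"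
      proof -
        have "T h - koenigs h = (T h - of_real \<beta> - h) - (koenigs h - of_real \<beta> - h)" by simp
        hence "norm (T h - koenigs h) \<le> norm (T h - of_real \<beta> - h) + norm (koenigs h - of_real \<beta> - h)"
          using norm_triangle_ineq4[of "T h - of_real \<beta> - h" "koenigs h - of_real \<beta> - h"] by metis
        thus ?thesis using add_mono[OF n[folded h_def]] unfolding mult_2 by (rule order_trans)
      qed
      finally have "norm (T z - koenigs z) \<le> 2 * \<beta> ^ n * (2 * (e' * (norm z / \<beta> ^ n)))"
        using beta_pos by simp
      also have "\<dots> = 4 * e' * norm z" using beta_pos by simp
      finally show ?thesis using e'(3) by linarith
    qed
    hence "norm (T z - koenigs z) \<le> 0" using field_le_epsilon[of "norm (T z - koenigs z)" 0] by fastforce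
    thus ?thesis by simp
  qed
  obtain m where m: "norm z / \<beta> ^ m < koenigs_radius / 2"
    using norm_div_power_less[of "koenigs_radius / 2"] koenigs_radius_pos by auto
  hence "T (z / of_real (\<beta> ^ m)) = koenigs (z / of_real (\<beta> ^ m))"
    using beta_pos by (intro small) (simp add: norm_divide norm_power)
  thus ?thesis using T_iter[of T z m, OF T(1)] T_iter[of koenigs z m, OF koenigs_scale] by simp
qed

text \<open>Existence and uniqueness together identify the definite description with the constructed
  limit.\<close>

lemma poincare_eq_koenigs: "poincare lam = koenigs"
  unfolding poincare_def
proof (rule the_equality)
  show "koenigs holomorphic_on UNIV \<and>
    (\<forall>z. koenigs (complex_of_real \<beta> * z) = Exp lam (koenigs z)) \<and>
    koenigs 0 = complex_of_real \<beta> \<and> deriv koenigs 0 = 1"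
    using koenigs_holomorphic koenigs_scale koenigs_0 koenigs_has_derivative_0 DERIV_imp_deriv by auto
next
  fix T assume T: "T holomorphic_on UNIV \<and>
    (\<forall>z. T (complex_of_real \<beta> * z) = Exp lam (T z)) \<and> T 0 = complex_of_real \<beta> \<and> deriv T 0 = 1"
  hence "(T has_field_derivative 1) (at 0)"
    using holomorphic_derivI[of T UNIV 0] by auto
  with T show "T = koenigs" using linearizer_eq_koenigs by blast
qed

section \<open>The real restriction and its inverse\<close>

lemma Expr_funpow_tendsto_Sreal: "(\<lambda>n. (Expr lam ^^ n) (\<beta> + t / \<beta> ^ n)) \<longlonglongrightarrow> Sreal lam t"
  and poincare_of_real: "poincare lam (of_real t) = of_real (Sreal lam t)"
proof -
  have ap: "approx n (of_real t) = of_real ((Expr lam ^^ n) (\<beta> + t / \<beta> ^ n))" for n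
    unfolding approx_def by (subst Exp_funpow_of_real [symmetric]) simp
  have "(\<lambda>n. Re (approx n (of_real t))) \<longlonglongrightarrow> Re (koenigs (of_real t))"
    "(\<lambda>n. Im (approx n (of_real t))) \<longlonglongrightarrow> Im (koenigs (of_real t))"
    by (intro tendsto_intros approx_tendsto)+
  hence *: "(\<lambda>n. (Expr lam ^^ n) (\<beta> + t / \<beta> ^ n)) \<longlonglongrightarrow> Re (koenigs (of_real t))"
    "Im (koenigs (of_real t)) = 0"
    by (simp_all add: ap LIMSEQ_const_iff)
  show "(\<lambda>n. (Expr lam ^^ n) (\<beta> + t / \<beta> ^ n)) \<longlonglongrightarrow> Sreal lam t"
    using * by (simp add: Sreal_def poincare_eq_koenigs)
  show "poincare lam (of_real t) = of_real (Sreal lam t)"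
    using * by (simp add: Sreal_def poincare_eq_koenigs complex_eq_iff)
qed

lemma Sreal_0 [simp]: "Sreal lam 0 = \<beta>"
  by (simp add: Sreal_def poincare_eq_koenigs koenigs_0)

lemma Sreal_scale: "Sreal lam (\<beta> * t) = Expr lam (Sreal lam t)"
proof -
  have "complex_of_real (Sreal lam (\<beta> * t)) = of_real (Expr lam (Sreal lam t))"
    using koenigs_scale[of "of_real t"] poincare_of_real[of "\<beta> * t"] poincare_of_real[of t]
    by (simp add: poincare_eq_koenigs Exp_of_real)
  thus ?thesis by (simp only: of_real_eq_iff)
qed

lemma Sreal_scale_power: "Sreal lam (\<beta> ^ n * t) = (Expr lam ^^ n) (Sreal lam t)"
  by (induction n) (simp_all add: mult.assoc Sreal_scale)

text \<open>To the right of \<beta> the \<open>n\<close>-th iterate expands by at least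
  \<open>\<beta> ^ n\<close>, which cancels the division by \<open>\<beta> ^ n\<close> in the
  approximants; the inequality survives the limit.\<close>

lemma Sreal_expand:
  assumes "0 \<le> s" "s \<le> t"
  shows "t - s \<le> Sreal lam t - Sreal lam s"
proof -
  have "t - s \<le> (Expr lam ^^ n) (\<beta> + t / \<beta> ^ n) - (Expr lam ^^ n) (\<beta> + s / \<beta> ^ n)" for n
  proof -
    have "\<beta> ^ n * ((\<beta> + t / \<beta> ^ n) - (\<beta> + s / \<beta> ^ n)) \<le>
        (Expr lam ^^ n) (\<beta> + t / \<beta> ^ n) - (Expr lam ^^ n) (\<beta> + s / \<beta> ^ n)"
      using assms beta_pos by (intro Expr_funpow_expand) (auto intro: divide_right_mono)
    moreover have "\<beta> ^ n * ((\<beta> + t / \<beta> ^ n) - (\<beta> + s / \<beta> ^ n)) = t - s"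
      using beta_pos by (simp add: field_simps)
    ultimately show ?thesis by simp
  qed
  thus ?thesis
    using LIMSEQ_le_const[OF tendsto_diff[OF Expr_funpow_tendsto_Sreal[of t] Expr_funpow_tendsto_Sreal[of s]]]
    by blast
qed

lemma Sreal_mono: "0 \<le> s \<Longrightarrow> s \<le> t \<Longrightarrow> Sreal lam s \<le> Sreal lam t"
  using Sreal_expand[of s t] by linarith

lemma Sreal_strict_mono: "0 \<le> s \<Longrightarrow> s < t \<Longrightarrow> Sreal lam s < Sreal lam t"
  using Sreal_expand[of s t] by linarith

lemma Sreal_nonpos: 
  assumes "t \<le> 0"
  shows "Sreal lam t \<le> \<beta>"
proof (rule LIMSEQ_le_const2[OF Expr_funpow_tendsto_Sreal])
  have "(Expr lam ^^ n) (\<beta> + t / \<beta> ^ n) \<le> \<beta>" for n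
    using Expr_funpow_mono[of "\<beta> + t / \<beta> ^ n" \<beta> n] assms beta_pos
    by (simp add: divide_nonpos_pos)
  thus "\<exists>N. \<forall>n\<ge>N. (Expr lam ^^ n) (\<beta> + t / \<beta> ^ n) \<le> \<beta>" by blast
qed

lemma continuous_on_Sreal: "continuous_on A (Sreal lam)"
proof -
  have "continuous_on UNIV koenigs"
    by (intro holomorphic_on_imp_continuous_on koenigs_holomorphic)
  hence "continuous_on A (\<lambda>t. koenigs (of_real t))"
    by (rule continuous_on_compose2[OF _ continuous_on_of_real_id]) auto
  hence "continuous_on A (\<lambda>t. Re (koenigs (of_real t)))"
    by (rule continuous_on_Re)
  thus ?thesis by (simp add: Sreal_def [abs_def] poincare_eq_koenigs)
qed

text \<open>\<open>Sreal_expand\<close> provides an upper bracket for the intermediate value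
  theorem. A preimage of \<open>x > \<beta>\<close> is positive by \<open>Sreal_nonpos\<close>, and
  strict monotonicity on that side makes it unique.\<close>

lemma Sinv:
  assumes "\<beta> < x"
  shows "0 < Sinv lam x" "Sreal lam (Sinv lam x) = x"
proof -
  have "\<exists>t\<ge>0. t \<le> x - \<beta> \<and> Sreal lam t = x"
    using assms Sreal_expand[of 0 "x - \<beta>"] by (intro IVT' continuous_on_Sreal) auto
  then obtain t where t: "t \<ge> 0" "Sreal lam t = x" by auto
  have eq: "t' = t" if "Sreal lam t' = x" for t'
  proof -
    have "t' > 0" using that Sreal_nonpos[of t'] assms by linarith
    thus ?thesis using t that Sreal_strict_mono[of t t'] Sreal_strict_mono[of t' t] by linarith
  qed
  have "Sinv lam x = t" unfolding Sinv_def
  proof (rule the_equality)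
    fix t' assume "poincare lam (of_real t') = of_real x"
    thus "t' = t" by (intro eq) (simp add: poincare_of_real)
  qed (simp add: poincare_of_real t)
  moreover have "t \<noteq> 0" using t assms by auto
  ultimately show "0 < Sinv lam x" "Sreal lam (Sinv lam x) = x" using t by auto
qed

lemma Lfrac_eq:
  assumes "\<beta> < x"
  shows "Lfrac lam eps x = Sreal lam (\<beta> powr (- eps) * Sinv lam x)"
  using assms alpha_less beta(1) by (simp add: Lfrac_def Efrac_def)

end

section \<open>The order on a hair\<close>

text \<open>The half-open strips tile the plane, so the index is the floor of
  \<open>(y / pi + 1) / 2\<close> and the definite description denotes.\<close>

lemma itinerary_bounds:
  "(2 * of_int (itinerary lam z j) - 1) * pi \<le> Im ((Exp lam ^^ j) z)"
  "Im ((Exp lam ^^ j) z) < (2 * of_int (itinerary lam z j) + 1) * pi"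
  and itinerary_eqI:
  "(2 * of_int s - 1) * pi \<le> Im ((Exp lam ^^ j) z) \<Longrightarrow>
    Im ((Exp lam ^^ j) z) < (2 * of_int s + 1) * pi \<Longrightarrow> itinerary lam z j = s"
proof -
  define y where "y = Im ((Exp lam ^^ j) z)"
  have iff: "(2 * of_int s - 1) * pi \<le> y \<and> y < (2 * of_int s + 1) * pi \<longleftrightarrow> s = \<lfloor>(y / pi + 1) / 2\<rfloor>" for s :: int
  proof -
    have "s = \<lfloor>(y / pi + 1) / 2\<rfloor> \<longleftrightarrow> of_int s \<le> (y / pi + 1) / 2 \<and> (y / pi + 1) / 2 < of_int s + 1"
      by (metis floor_eq_iff)
    also have "\<dots> \<longleftrightarrow> 2 * of_int s - 1 \<le> y / pi \<and> y / pi < 2 * of_int s + 1"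
      by auto
    also have "\<dots> \<longleftrightarrow> (2 * of_int s - 1) * pi \<le> y \<and> y < (2 * of_int s + 1) * pi"
      by (simp add: pos_le_divide_eq pos_divide_less_eq)
    finally show ?thesis by simp
  qed
  hence it: "itinerary lam z j = \<lfloor>(y / pi + 1) / 2\<rfloor>"
    unfolding itinerary_def y_def by simp
  show "(2 * of_int (itinerary lam z j) - 1) * pi \<le> Im ((Exp lam ^^ j) z)"
    "Im ((Exp lam ^^ j) z) < (2 * of_int (itinerary lam z j) + 1) * pi"
    using iff[of "itinerary lam z j"] it by (simp_all add: y_def)
  show "itinerary lam z j = s"
    if "(2 * of_int s - 1) * pi \<le> Im ((Exp lam ^^ j) z)" "Im ((Exp lam ^^ j) z) < (2 * of_int s + 1) * pi"
    using iff[of s] it that by (simp add: y_def)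
qed

context small_exponential
begin

section \<open>Inverse branches and expansion along a hair\<close>

text \<open>The inverse branch of \<open>Exp lam\<close> whose values lie in the strip about height
  \<open>2 * pi * s\<close>.\<close>

definition branch :: "int \<Rightarrow> complex \<Rightarrow> complex" where
  "branch s z = Ln z - of_real (ln lam) + of_real (2 * pi * of_int s) * \<i>"

lemma exp_2pi_int: "exp (complex_of_real (2 * pi * of_int s) * \<i>) = 1"
  by (metis exp_integer_2pi Ints_of_int mult.assoc mult.commute of_real_mult of_real_of_int_eq of_real_numeral)

lemma Re_branch: "z \<noteq> 0 \<Longrightarrow> Re (branch s z) = ln (norm z) - ln lam"
  by (simp add: branch_def)

lemma Im_branch: "Im (branch s z) = Im (Ln z) + 2 * pi * of_int s"
  by (simp add: branch_def)

lemma Exp_branch: "z \<noteq> 0 \<Longrightarrow> Exp lam (branch s z) = z"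
proof -
  assume "z \<noteq> 0"
  have "exp (complex_of_real (ln lam)) = of_real lam"
    using lam_pos by (metis exp_ln exp_of_real)
  thus ?thesis using \<open>z \<noteq> 0\<close> lam_pos
    by (simp only: branch_def Exp_def exp_add exp_diff exp_2pi_int exp_Ln) simp
qed

lemma branch_Exp:
  assumes "0 < Re (Exp lam z)" "\<bar>Im z - 2 * pi * of_int s\<bar> \<le> pi"
  shows "branch s (Exp lam z) = z"
proof -
  define u where "u = z + of_real (ln lam) - of_real (2 * pi * of_int s) * \<i>"
  have "exp (complex_of_real (ln lam)) = of_real lam"
    using lam_pos by (metis exp_ln exp_of_real)
  hence eu: "exp u = Exp lam z"
    by (simp only: u_def Exp_def exp_add exp_diff exp_2pi_int) simp
  \<comment> \<open>The strip is closed, while the principal logarithm omits its lower edge. That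
    edge is sent to the negative reals, which the positive real part excludes.\<close>
  have "0 < cos (Im u)"
    using assms(1) unfolding eu[symmetric] by (simp add: Re_exp zero_less_mult_iff)
  hence "Im u \<noteq> - pi" by auto
  moreover have "\<bar>Im u\<bar> \<le> pi" using assms(2) by (simp add: u_def)
  ultimately have "Ln (exp u) = u" by (intro Ln_exp) auto
  hence "branch s (Exp lam z) = u - of_real (ln lam) + of_real (2 * pi * of_int s) * \<i>"
    unfolding branch_def eu by simp
  thus ?thesis by (simp add: u_def)
qed

lemma branch_lipschitz:
  assumes "\<beta> \<le> Re z" "\<beta> \<le> Re w"
  shows "norm (branch s z - branch s w) \<le> 1 / \<beta> * norm (z - w)"
proof (rule field_differentiable_bound[where S = "{z. \<beta> \<le> Re z}" and f' = inverse])
  fix x assume "x \<in> {z. \<beta> \<le> Re z}"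
  hence x: "\<beta> \<le> Re x" by simp
  hence "x \<notin> \<real>\<^sub>\<le>\<^sub>0" using beta_pos complex_nonpos_Reals_iff by force
  thus "(branch s has_field_derivative inverse x) (at x within {z. \<beta> \<le> Re z})"
    unfolding branch_def [abs_def] by (auto intro!: derivative_eq_intros simp: inverse_eq_divide)
  have "\<beta> \<le> norm x" using x complex_Re_le_cmod order_trans by blast
  thus "norm (inverse x) \<le> 1 / \<beta>"
    using beta_pos by (simp add: inverse_eq_divide norm_divide frac_le)
qed (use assms in \<open>auto intro: convex_halfspace_Re_ge\<close>)

text \<open>Both points are recovered from their images by the same branch, which contracts by
  \<open>1 / \<beta>\<close> on the half-plane.\<close>

lemma Exp_expand:
  assumes "\<beta> \<le> Re (Exp lam z)" "\<beta> \<le> Re (Exp lam w)"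
    and "\<bar>Im z - 2 * pi * of_int s\<bar> \<le> pi" "\<bar>Im w - 2 * pi * of_int s\<bar> \<le> pi"
  shows "\<beta> * norm (z - w) \<le> norm (Exp lam z - Exp lam w)"
proof -
  have "norm (branch s (Exp lam z) - branch s (Exp lam w)) \<le> 1 / \<beta> * norm (Exp lam z - Exp lam w)"
    using assms by (intro branch_lipschitz) auto
  moreover have "branch s (Exp lam z) = z" "branch s (Exp lam w) = w"
    using assms beta_pos by (auto intro!: branch_Exp)
  ultimately show ?thesis using beta_pos by (simp add: field_simps)
qed

lemma itinerary_strip: "\<bar>Im ((Exp lam ^^ j) z) - 2 * pi * of_int (itinerary lam z j)\<bar> \<le> pi"
  using itinerary_bounds[where lam = lam and z = z and j = j] by (simp add: algebra_simps abs_le_iff)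

lemma hair_Im_diff:
  assumes "itinerary lam z = itinerary lam w"
  shows "\<bar>Im ((Exp lam ^^ j) z) - Im ((Exp lam ^^ j) w)\<bar> \<le> 2 * pi"
  using itinerary_strip[of j z] itinerary_strip[of j w] assms by (simp add: abs_le_iff)

lemma hair_expand:
  assumes "z \<in> julia_set (Exp lam)" "w \<in> julia_set (Exp lam)" "itinerary lam z = itinerary lam w"
  shows "\<beta> ^ n * norm (z - w) \<le> norm ((Exp lam ^^ n) z - (Exp lam ^^ n) w)"
proof (induction n)
  case (Suc n)
  have "\<beta> ^ Suc n * norm (z - w) \<le> \<beta> * norm ((Exp lam ^^ n) z - (Exp lam ^^ n) w)"
    using Suc beta_pos by (simp add: mult.assoc)
  also have "\<dots> \<le> norm (Exp lam ((Exp lam ^^ n) z) - Exp lam ((Exp lam ^^ n) w))"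
    using julia_setD[OF assms(1), of "Suc n"] julia_setD[OF assms(2), of "Suc n"]
      itinerary_strip[of n z] itinerary_strip[of n w] assms(3)
    by (intro Exp_expand) auto
  finally show ?case by simp
qed simp

text \<open>Any sufficiently large constant would do in place of 4.\<close>
lemma Exp_gap:
  assumes "Re w + 4 \<le> Re z" "\<beta> \<le> Re (Exp lam w)" "\<beta> \<le> Re (Exp lam z)"
    and "\<bar>Im (Exp lam z) - Im (Exp lam w)\<bar> \<le> 2 * pi"
  shows "Re (Exp lam w) + 4 \<le> Re (Exp lam z)"
proof -
  define m where "m = norm (Exp lam w)"
  have m: "Re (Exp lam w) \<le> m" "\<bar>Im (Exp lam w)\<bar> \<le> m"
    unfolding m_def by (rule complex_Re_le_cmod abs_Im_le_cmod)+
  \<comment> \<open>Since \<open>exp 4 >= 16\<close>, the image of \<open>z\<close> has modulus at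
    least \<open>16 * m\<close>. Its imaginary part takes up at most \<open>m + 2 * pi\<close>, and
    the rest exceeds \<open>m + 4\<close> because \<open>m > 1\<close>.\<close>
  have "2 ^ 4 \<le> exp (1::real) ^ 4"
    using exp_ge_add_one_self[of 1] by (intro power_mono) auto
  also have "exp (1::real) ^ 4 = exp 4" by (simp flip: exp_of_nat_mult)
  finally have "16 * m \<le> exp 4 * m" using m beta_pos assms by (intro mult_right_mono) auto
  also have "\<dots> = Expr lam (Re w + 4)" by (simp add: m_def norm_Exp Expr_def exp_add)
  also have "\<dots> \<le> norm (Exp lam z)" unfolding norm_Exp by (rule Expr_mono[OF assms(1)])
  also have "\<dots> \<le> \<bar>Re (Exp lam z)\<bar> + \<bar>Im (Exp lam z)\<bar>" by (rule cmod_le)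
  finally show ?thesis using m assms beta(1) pi_less_4 by linarith
qed

lemma hair_gap_mono:
  assumes "z \<in> julia_set (Exp lam)" "w \<in> julia_set (Exp lam)" "itinerary lam z = itinerary lam w"
    and "Re ((Exp lam ^^ n) w) + 4 \<le> Re ((Exp lam ^^ n) z)" "n \<le> m"
  shows "Re ((Exp lam ^^ m) w) + 4 \<le> Re ((Exp lam ^^ m) z)"
  using assms(5,4)
proof (induction m rule: dec_induct)
  case (step m)
  show ?case
    using Exp_gap[OF step.IH[OF step.prems]] hair_Im_diff[OF assms(3), of "Suc m"]
      julia_setD[OF assms(1), of "Suc m"] julia_setD[OF assms(2), of "Suc m"] by simp
qed

text \<open>The distance of the orbits grows beyond every bound, but their imaginary parts never
  differ by more than \<open>2 * pi\<close>; hence the real parts must separate.\<close>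

lemma hair_gap_exists:
  assumes "z \<in> julia_set (Exp lam)" "w \<in> julia_set (Exp lam)" "itinerary lam z = itinerary lam w"
    and "z \<noteq> w"
  obtains n where "\<bar>Re ((Exp lam ^^ n) z) - Re ((Exp lam ^^ n) w)\<bar> > 4"
proof -
  have pos: "0 < norm (z - w)" using assms(4) by simp
  obtain n where "14 / norm (z - w) < \<beta> ^ n" using real_arch_pow[OF beta(1)] by blast
  hence "14 < \<beta> ^ n * norm (z - w)" using pos by (simp add: field_simps)
  also have "\<dots> \<le> norm ((Exp lam ^^ n) z - (Exp lam ^^ n) w)"
    by (rule hair_expand[OF assms(1-3)])
  also have "\<dots> \<le> \<bar>Re ((Exp lam ^^ n) z) - Re ((Exp lam ^^ n) w)\<bar> + \<bar>Im ((Exp lam ^^ n) z) - Im ((Exp lam ^^ n) w)\<bar>"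
    using cmod_le[of "(Exp lam ^^ n) z - (Exp lam ^^ n) w"] by simp
  finally show ?thesis using hair_Im_diff[OF assms(3), of n] pi_less_4 by (intro that[of n]) linarith
qed

section \<open>A criterion for not being an endpoint\<close>

text \<open>If \<open>w\<close> were an endpoint, the hair without \<open>w\<close> would be the
  connected image of the open half-line. The points eventually to the right and those eventually to
  the left of \<open>w\<close> would disconnect it: the left part contains \<open>v\<close>, the
  right part contains the points near infinity.\<close>

lemma not_endpointI:
  assumes w: "w \<in> julia_set (Exp lam)" and v: "v \<in> hair lam w"
    and vw: "Re ((Exp lam ^^ n) v) + 4 < Re ((Exp lam ^^ n) w)"
  shows "w \<notin> endpoints lam"
proof
  assume "w \<in> endpoints lam"
  then obtain \<gamma> :: "real \<Rightarrow> complex" where \<gamma>: "continuous_on {0..} \<gamma>" "inj_on \<gamma> {0..}" "\<gamma> 0 = w"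
    "\<gamma> ` {0..} = hair lam w" "filterlim (\<lambda>t. norm (\<gamma> t)) at_top at_top"
    by (auto simp: endpoints_def)
  let ?E = "\<lambda>n z. (Exp lam ^^ n) z"
  define Up where "Up = (\<Union>n. {z. Re (?E n w) + 4 < Re (?E n z)})"
  define Lo where "Lo = (\<Union>n. {z. Re (?E n z) < Re (?E n w) - 4})"
  have "open Up" "open Lo" unfolding Up_def Lo_def
    by (intro open_UN ballI open_Collect_less continuous_intros Exp_funpow_continuous)+
  have hairD: "z \<in> julia_set (Exp lam)" "itinerary lam z = itinerary lam w" if "z \<in> hair lam w" for z
    using that by (auto simp: hair_def)
  let ?C = "\<gamma> ` {0<..}"
  have C_hair: "?C \<subseteq> hair lam w" using \<gamma>(4) by (auto simp: image_subset_iff)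
  have conn: "connected ?C"
    by (rule connected_continuous_image)
      (auto intro: continuous_on_subset[OF \<gamma>(1)])
  have w_notin: "w \<notin> ?C"
    using \<gamma>(2,3) by (auto simp: inj_on_def) (metis atLeast_iff less_eq_real_def less_irrefl)
  have cover: "?C \<subseteq> Up \<union> Lo"
  proof
    fix z assume z: "z \<in> ?C"
    with w_notin have "z \<noteq> w" by auto
    moreover have "z \<in> hair lam w" using z C_hair by auto
    ultimately obtain n where "\<bar>Re (?E n z) - Re (?E n w)\<bar> > 4"
      using hair_gap_exists[of z w] hairD w by metis
    hence "Re (?E n w) + 4 < Re (?E n z) \<or> Re (?E n z) < Re (?E n w) - 4" by linarith
    thus "z \<in> Up \<union> Lo" unfolding Up_def Lo_def by blast
  qed
  have disj: "Up \<inter> Lo \<inter> ?C = {}"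
  proof (rule ccontr)
    assume "Up \<inter> Lo \<inter> ?C \<noteq> {}"
    then obtain z i j where z: "z \<in> hair lam w" and
      ij: "Re (?E i w) + 4 < Re (?E i z)" "Re (?E j z) < Re (?E j w) - 4"
      using C_hair unfolding Up_def Lo_def by blast
    \<comment> \<open>Gaps persist, so both would be present at the later of the two times.\<close>
    have "Re (?E (max i j) w) + 4 \<le> Re (?E (max i j) z)"
      using hair_gap_mono[OF hairD(1)[OF z] w hairD(2)[OF z], of i "max i j"] ij by simp
    moreover have "Re (?E (max i j) z) + 4 \<le> Re (?E (max i j) w)"
      using hair_gap_mono[OF w hairD(1)[OF z] hairD(2)[OF z, symmetric], of j "max i j"] ij by simp
    ultimately show False by linarith
  qed
  have "Lo \<inter> ?C \<noteq> {}"
  proof -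
    obtain t where t: "t \<ge> 0" "\<gamma> t = v" using v \<gamma>(4) by (metis atLeast_iff imageE)
    have "t \<noteq> 0" using t \<gamma>(3) vw by auto
    with t have "v \<in> ?C" by force
    moreover have "v \<in> Lo" unfolding Lo_def using vw by (force simp: algebra_simps)
    ultimately show ?thesis by auto
  qed
  moreover have "Up \<inter> ?C \<noteq> {}"
  proof -
    \<comment> \<open>On the hair the imaginary part stays within \<open>2 * pi\<close> of that of
      \<open>w\<close> and the real part is positive, so a norm above \<open>M\<close> forces the
      real part beyond \<open>Re w + 4\<close> already at time 0.\<close>
    define M where "M = \<bar>Re w\<bar> + 4 + \<bar>Im w\<bar> + 2 * pi"
    have "\<forall>\<^sub>F t in at_top. M < norm (\<gamma> t)"
      using \<gamma>(5) by (simp add: filterlim_at_top_dense)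
    then obtain t where t: "t > 0" "M < norm (\<gamma> t)"
      using eventually_happens[OF eventually_conj[OF eventually_gt_at_top[of 0]]]
      by (metis (no_types, lifting) trivial_limit_at_top_linorder)
    have h: "\<gamma> t \<in> hair lam w" using t \<gamma>(4) by (metis atLeast_iff imageI less_imp_le)
    have "\<bar>Im (\<gamma> t) - Im w\<bar> \<le> 2 * pi" using hair_Im_diff[OF hairD(2)[OF h], of 0] by simp
    moreover have "\<beta> \<le> Re (\<gamma> t)" using julia_setD[OF hairD(1)[OF h], of 0] by simp
    moreover have "norm (\<gamma> t) \<le> \<bar>Re (\<gamma> t)\<bar> + \<bar>Im (\<gamma> t)\<bar>" by (rule cmod_le)
    ultimately have "Re w + 4 < Re (\<gamma> t)" using t(2) beta_pos unfolding M_def by linarith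
    hence "\<gamma> t \<in> Up" unfolding Up_def by (intro UN_I[of 0]) auto
    thus ?thesis using t(1) by auto
  qed
  ultimately show False
    using connectedD[OF conn \<open>open Up\<close> \<open>open Lo\<close> disj cover] by simp
qed

section \<open>A slowly growing point on the same hair\<close>

text \<open>The boxes \<open>D k\<close> lie in the strips of the itinerary of \<open>w\<close>, and
  \<open>branch (s k)\<close> maps \<open>D (Suc k)\<close> into \<open>D k\<close>. So the compact
  sets of points that follow the boxes up to time \<open>n\<close> are nonempty and nested, and a
  common point follows them forever.\<close>

lemma hair_slow_point:
  assumes w: "w \<in> julia_set (Exp lam)" and a: "\<beta> \<le> a" and Y: "0 \<le> Y"
    and Im_le: "\<And>j. \<bar>Im ((Exp lam ^^ j) w)\<bar> \<le> (Expr lam ^^ j) a + Y"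
  obtains v K where "v \<in> hair lam w" "\<And>j. Re ((Exp lam ^^ j) v) \<le> (Expr lam ^^ j) a + K"
proof -
  \<comment> \<open>Large enough for \<open>2 + K + Y + 2 * pi <= exp K\<close>: a point of the next
    box has modulus at most \<open>exp K\<close> times \<open>(Expr lam ^^ Suc k) a\<close>, so its
    logarithm returns below \<open>(Expr lam ^^ k) a + K\<close>.\<close>
  define K where "K = Y + 10"
  define s where "s = itinerary lam w"
  define D where "D k = {z. \<beta> \<le> Re z \<and> Re z \<le> (Expr lam ^^ k) a + K \<and> \<bar>Im z - 2 * pi * of_int (s k)\<bar> \<le> pi}" for k
  have a_ge: "\<beta> \<le> (Expr lam ^^ k) a" for k
    using Expr_funpow_mono[OF a, of k] by simp
  have K: "2 + K + Y + 2 * pi \<le> exp K"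
  proof -
    have "1 + K + K\<^sup>2 / 2 \<le> exp K" using Y by (intro exp_lower_Taylor_quadratic) (simp add: K_def)
    moreover have "10 * K \<le> K\<^sup>2" using Y unfolding power2_eq_square by (intro mult_right_mono) (auto simp: K_def)
    ultimately show ?thesis using pi_less_4 Y by (simp add: K_def)
  qed
  have s_le: "2 * pi * \<bar>of_int (s k)\<bar> \<le> (Expr lam ^^ k) a + Y + pi" for k
    using itinerary_strip[of k w] Im_le[of k] unfolding s_def by (simp add: abs_if split: if_splits)
  have branch_D: "branch (s k) z \<in> D k" if z: "z \<in> D (Suc k)" for k z
  proof -
    define b where "b = (Expr lam ^^ Suc k) a"
    have b1: "1 < b" using a_ge[of "Suc k"] beta(1) by (simp add: b_def)
    have Rez: "\<beta> \<le> Re z" "Re z \<le> b + K" "\<bar>Im z - 2 * pi * of_int (s (Suc k))\<bar> \<le> pi"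
      using z by (auto simp: D_def b_def)
    have nz: "\<beta> \<le> norm z" using Rez(1) complex_Re_le_cmod order_trans by blast
    hence z0: "z \<noteq> 0" using beta_pos by auto
    have "\<bar>2 * pi * of_int (s (Suc k))\<bar> \<le> b + Y + pi"
      using s_le[of "Suc k"] by (simp add: abs_mult b_def)
    hence "norm z \<le> 2 * b + (K + Y + 2 * pi)"
      using cmod_le[of z] Rez beta_pos by linarith
    also have "\<dots> \<le> 2 * b + (K + Y + 2 * pi) * b"
    proof -
      have "0 \<le> K + Y + 2 * pi" using Y pi_gt_zero by (simp add: K_def)
      from mult_left_mono[OF less_imp_le[OF b1] this] show ?thesis by simp
    qed
    also have "\<dots> = (2 + K + Y + 2 * pi) * b" by (simp add: algebra_simps)
    also have "\<dots> \<le> exp K * b" using K b1 by (intro mult_right_mono) auto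
    also have "\<dots> = lam * exp (K + (Expr lam ^^ k) a)" by (simp add: b_def Expr_def exp_add)
    finally have "ln (norm z) \<le> ln (lam * exp (K + (Expr lam ^^ k) a))"
      using z0 by (intro ln_mono) auto
    also have "\<dots> = ln lam + (K + (Expr lam ^^ k) a)" using lam_pos by (simp add: ln_mult)
    finally have up: "Re (branch (s k) z) \<le> (Expr lam ^^ k) a + K"
      using z0 by (simp add: Re_branch)
    \<comment> \<open>The fixed point equation in logarithmic form: the branch sends modulus at
      least \<beta> to real part at least \<beta>.\<close>
    have "ln \<beta> = ln (lam * exp \<beta>)" by (simp only: beta(2))
    also have "\<dots> = ln lam + \<beta>" using lam_pos by (simp add: ln_mult)
    finally have "ln \<beta> = ln lam + \<beta>" .
    moreover have "ln \<beta> \<le> ln (norm z)" using nz beta_pos by (intro ln_mono) auto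
    ultimately have lo: "\<beta> \<le> Re (branch (s k) z)" using z0 by (simp add: Re_branch)
    have "\<bar>Im (Ln z)\<bar> < pi / 2" using Rez(1) beta_pos by (intro Re_Ln_pos_lt_imp) auto
    hence "\<bar>Im (branch (s k) z) - 2 * pi * of_int (s k)\<bar> \<le> pi"
      by (simp add: Im_branch)
    with up lo show ?thesis by (simp add: D_def)
  qed
  define A where "A n = {z. \<forall>k\<le>n. (Exp lam ^^ k) z \<in> D k}" for n
  have pull: "\<exists>z. (\<forall>k\<le>n. (Exp lam ^^ k) z \<in> D k) \<and> (Exp lam ^^ n) z = d" if "d \<in> D n" for n d
    using that
  proof (induction n arbitrary: d)
    case 0
    thus ?case by (intro exI[of _ d]) auto
  next
    case (Suc n)
    from Suc.IH[OF branch_D[OF Suc.prems]] obtain z where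
      z: "\<forall>k\<le>n. (Exp lam ^^ k) z \<in> D k" "(Exp lam ^^ n) z = branch (s n) d" by blast
    have "d \<noteq> 0" using Suc.prems beta_pos by (auto simp: D_def)
    hence "(Exp lam ^^ Suc n) z = d" using z(2) by (simp add: Exp_branch)
    thus ?case using z(1) Suc.prems by (intro exI[of _ z]) (auto simp: le_Suc_eq)
  qed
  have closed_D: "closed (D k)" for k
    unfolding D_def by (intro closed_Collect_conj closed_Collect_le continuous_intros)
  have "\<Inter>(range A) \<noteq> {}"
  proof (rule compact_nest)
    fix n
    have "A n = (\<Inter>k\<in>{..n}. (Exp lam ^^ k) -` D k)" by (auto simp: A_def)
    hence "closed (A n)"
      using closed_vimage[OF closed_D Exp_funpow_continuous] by auto
    moreover have "A n \<subseteq> D 0" by (auto simp: A_def)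
    moreover have "bounded (D 0)"
    proof (rule boundedI)
      fix x assume x: "x \<in> D 0"
      hence "\<bar>Re x\<bar> \<le> a + K" "\<bar>Im x - 2 * pi * of_int (s 0)\<bar> \<le> pi"
        using beta_pos by (auto simp: D_def)
      thus "norm x \<le> a + K + (\<bar>2 * pi * of_int (s 0)\<bar> + pi)"
        using cmod_le[of x] by linarith
    qed
    ultimately show "compact (A n)"
      using bounded_subset compact_eq_bounded_closed by blast
    have "Complex \<beta> (2 * pi * of_int (s n)) \<in> D n"
      using a_ge[of n] Y by (simp add: D_def K_def)
    from pull[OF this] show "A n \<noteq> {}" by (auto simp: A_def)
  next
    show "A n \<subseteq> A m" if "m \<le> n" for m n
      using that by (auto simp: A_def)
  qed
  then obtain v where "\<And>n. v \<in> A n" by blast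
  hence v: "(Exp lam ^^ k) v \<in> D k" for k by (auto simp: A_def)
  have v_julia: "v \<in> julia_set (Exp lam)"
    using v by (intro julia_setI) (auto simp: D_def)
  have "itinerary lam v = s"
  proof
    fix j
    \<comment> \<open>Membership in the closed strip alone does not decide the itinerary on its
      upper edge. As a branch value of a point with positive real part, the iterate lies within
      \<open>pi / 2\<close> of the centre line.\<close>
    have "(Exp lam ^^ j) v = branch (s j) ((Exp lam ^^ Suc j) v)"
      using v[of j] v[of "Suc j"] beta_pos by (subst funpow.simps(2), unfold o_def, subst branch_Exp) (auto simp: D_def)
    hence "Im ((Exp lam ^^ j) v) = Im (Ln ((Exp lam ^^ Suc j) v)) + 2 * pi * of_int (s j)"
      by (metis Im_branch)
    moreover have "\<bar>Im (Ln ((Exp lam ^^ Suc j) v))\<bar> < pi / 2"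
      using v[of "Suc j"] beta_pos by (intro Re_Ln_pos_lt_imp) (auto simp: D_def)
    ultimately show "itinerary lam v j = s j"
      by (intro itinerary_eqI) (auto simp: algebra_simps abs_if split: if_splits)
  qed
  hence "v \<in> hair lam w" using v_julia by (simp add: hair_def s_def)
  moreover have "Re ((Exp lam ^^ j) v) \<le> (Expr lam ^^ j) a + K" for j
    using v[of j] by (simp add: D_def)
  ultimately show ?thesis using that by blast
qed

end

section \<open>Orbit growth in the linearising coordinate\<close>

theorem theorem1p5:
  fixes lam x0 eps :: real
  assumes "0 < lam" and "lam < 1 / exp 1" and "beta lam < x0" and "0 < eps"
  shows "{w::complex. \<forall>j::nat.
             (Expr lam ^^ j) x0 < Re ((Exp lam ^^ j) w) \<and>
             x0 < Re ((Exp lam ^^ j) w) \<and>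
             \<bar>Im ((Exp lam ^^ j) w)\<bar> < Lfrac lam eps (Re ((Exp lam ^^ j) w))}
         \<subseteq> julia_set (Exp lam) - endpoints lam"
proof
  interpret small_exponential lam using assms by unfold_locales
  fix w assume "w \<in> {w::complex. \<forall>j::nat.
             (Expr lam ^^ j) x0 < Re ((Exp lam ^^ j) w) \<and>
             x0 < Re ((Exp lam ^^ j) w) \<and>
             \<bar>Im ((Exp lam ^^ j) w)\<bar> < Lfrac lam eps (Re ((Exp lam ^^ j) w))}"
  hence w: "(Expr lam ^^ j) x0 < Re ((Exp lam ^^ j) w)" "x0 < Re ((Exp lam ^^ j) w)"
    "\<bar>Im ((Exp lam ^^ j) w)\<bar> < Lfrac lam eps (Re ((Exp lam ^^ j) w))" for j
    by auto
  have w_julia: "w \<in> julia_set (Exp lam)"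
    using w(2) assms(3) by (intro julia_setI) (meson less_imp_le less_trans)
  define x where "x j = Re ((Exp lam ^^ j) w)" for j
  define t where "t j = Sinv lam (x j)" for j
  \<comment> \<open>In the coordinate \<open>Sinv\<close> the real map is multiplication by \<beta>,
    so \<open>u\<close> would be constant on a real orbit; here it measures the growth lost to
    imaginary parts.\<close>
  define u where "u j = t j / \<beta> ^ j" for j
  define t0 where "t0 = Sinv lam x0"
  have x_gt: "\<beta> < x j" for j using w(2)[of j] assms(3) by (simp add: x_def)
  have t: "0 < t j" "Sreal lam (t j) = x j" for j
    using Sinv[OF x_gt] by (simp_all add: t_def)
  have t0: "0 < t0" "Sreal lam t0 = x0"
    using Sinv[OF assms(3)] by (simp_all add: t0_def)
  have \<beta>n: "0 < \<beta> ^ j" for j using beta_pos by simp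
  \<comment> \<open>The assumed growth beyond the orbit of \<open>x0\<close> keeps \<open>u\<close>
    away from 0, so its limit is positive.\<close>
  have u_ge: "t0 \<le> u j" for j
  proof (rule ccontr)
    assume "\<not> t0 \<le> u j"
    hence "t j < \<beta> ^ j * t0" using \<beta>n[of j] by (simp add: u_def field_simps)
    hence "Sreal lam (t j) < Sreal lam (\<beta> ^ j * t0)"
      using t(1)[of j] by (intro Sreal_strict_mono) auto
    thus False using w(1)[of j] by (simp add: t Sreal_scale_power t0 x_def)
  qed
  have "t (Suc j) \<le> \<beta> * t j" for j
  proof (rule ccontr)
    assume "\<not> t (Suc j) \<le> \<beta> * t j"
    hence "Sreal lam (\<beta> * t j) < Sreal lam (t (Suc j))"
      using t(1)[of j] beta_pos by (intro Sreal_strict_mono) auto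
    hence "Expr lam (x j) < x (Suc j)" by (simp add: Sreal_scale t)
    moreover have "x (Suc j) \<le> norm ((Exp lam ^^ Suc j) w)"
      unfolding x_def by (rule complex_Re_le_cmod)
    ultimately show False by (simp add: norm_Exp x_def)
  qed
  hence u_Suc: "u (Suc j) \<le> u j" for j
    using \<beta>n[of "Suc j"] beta_pos by (simp add: u_def field_simps)
  hence dec: "decseq u" by (rule decseq_SucI)
  obtain \<tau> where lim: "u \<longlonglongrightarrow> \<tau>" and \<tau>_le: "\<And>j. \<tau> \<le> u j"
    using decseq_convergent[OF dec, of t0] u_ge by blast
  have "t0 \<le> \<tau>" using LIMSEQ_le_const[OF lim] u_ge by blast
  with t0 have \<tau>_pos: "0 < \<tau>" by simp
  \<comment> \<open>A square root of the factor \<open>\<beta> powr (- eps)\<close>: one factor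
    \<open>p\<close> absorbs the error in \<open>u j < \<tau> / p\<close>, the other makes
    \<open>a\<close> strictly smaller than \<open>b\<close>.\<close>
  define p where "p = \<beta> powr (- (eps / 2))"
  have p: "0 < p" "p < 1" "\<beta> powr (- eps) = p * p"
    using beta assms(4) by (auto simp: p_def powr_less_one simp flip: powr_add)
  have "\<tau> < \<tau> / p" using p \<tau>_pos by (simp add: field_simps)
  hence "\<forall>\<^sub>F j in sequentially. u j < \<tau> / p"
    using order_tendstoD(2)[OF lim] by blast
  then obtain N where N: "\<And>j. N \<le> j \<Longrightarrow> u j < \<tau> / p"
    by (auto simp: eventually_sequentially)
  define a where "a = Sreal lam (p * \<tau>)"
  define b where "b = Sreal lam \<tau>"
  have ab: "\<beta> \<le> a" "a < b"
    using Sreal_mono[of 0 "p * \<tau>"] Sreal_strict_mono[of "p * \<tau>" \<tau>] p \<tau>_pos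
    by (auto simp: a_def b_def)
  have Re_ge: "(Expr lam ^^ j) b \<le> x j" for j
  proof -
    have "\<beta> ^ j * \<tau> \<le> t j" using \<tau>_le[of j] \<beta>n[of j] by (simp add: u_def field_simps)
    hence "Sreal lam (\<beta> ^ j * \<tau>) \<le> Sreal lam (t j)"
      using \<tau>_pos \<beta>n[of j] by (intro Sreal_mono) auto
    thus ?thesis by (simp add: Sreal_scale_power b_def t)
  qed
  have Im_le: "\<bar>Im ((Exp lam ^^ j) w)\<bar> \<le> (Expr lam ^^ j) a" if "N \<le> j" for j
  proof -
    have "p * (p * t j) \<le> p * (\<beta> ^ j * \<tau>)"
      using N[OF that] p \<beta>n[of j] by (intro mult_left_mono) (auto simp: u_def field_simps)
    hence "Sreal lam (\<beta> powr (- eps) * t j) \<le> Sreal lam (\<beta> ^ j * (p * \<tau>))"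
      unfolding p(3) using p t(1)[of j] by (intro Sreal_mono) (auto simp: mult_ac)
    hence "Lfrac lam eps (x j) \<le> (Expr lam ^^ j) a"
      by (simp add: Lfrac_eq[OF x_gt] Sreal_scale_power a_def t_def)
    thus ?thesis using w(3)[of j] by (simp add: x_def)
  qed
  \<comment> \<open>Covers the finitely many times before \<open>N\<close>, at which the bound by
    the orbit of \<open>a\<close> may fail.\<close>
  define Y where "Y = (\<Sum>j<N. \<bar>Im ((Exp lam ^^ j) w)\<bar>)"
  have Y: "0 \<le> Y" by (simp add: Y_def sum_nonneg)
  have "\<bar>Im ((Exp lam ^^ j) w)\<bar> \<le> (Expr lam ^^ j) a + Y" for j
  proof (cases "N \<le> j")
    case True
    with Im_le[of j] Y show ?thesis by linarith
  next
    case False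
    hence "\<bar>Im ((Exp lam ^^ j) w)\<bar> \<le> Y"
      unfolding Y_def by (intro member_le_sum) auto
    moreover have "0 \<le> (Expr lam ^^ j) a" using Expr_funpow_mono[OF ab(1), of j] beta_pos by simp
    ultimately show ?thesis by linarith
  qed
  then obtain v K where v: "v \<in> hair lam w" "\<And>j. Re ((Exp lam ^^ j) v) \<le> (Expr lam ^^ j) a + K"
    using hair_slow_point[OF w_julia ab(1) Y] by blast
  \<comment> \<open>The orbits of \<open>a\<close> and \<open>b\<close> separate at least like
    \<open>\<beta> ^ n\<close>, which eventually outweighs the additive constant \<open>K\<close>
    and the required gap 4.\<close>
  obtain n where "(K + 4) / (b - a) < \<beta> ^ n" using real_arch_pow[OF beta(1)] by blast
  hence "K + 4 < \<beta> ^ n * (b - a)" using ab(2) by (simp add: field_simps)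
  also have "\<dots> \<le> (Expr lam ^^ n) b - (Expr lam ^^ n) a"
    using ab by (intro Expr_funpow_expand) auto
  finally have "Re ((Exp lam ^^ n) v) + 4 < Re ((Exp lam ^^ n) w)"
    using v(2)[of n] Re_ge[of n] by (simp add: x_def)
  hence "w \<notin> endpoints lam" by (rule not_endpointI[OF w_julia v(1)])
  with w_julia show "w \<in> julia_set (Exp lam) - endpoints lam" by simp
qed

end
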